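(* Let $S$ be any proper subset of the set of prime numbers (possibly infinite). Then: (i) If $|S|=1$, the set \[ \Gamma:=\left\{\xi\in\mathbb{R}:\ \limsup_{Q\to\infty}\;Q\min_{q\in\mathbb{Z},\,0<q\le Q}\Vert q\xi\Vert\cdot|q|_S=1\right\} \] is a dense $G_\delta$ set, has Hausdorff dimension at least $1/2$, has full packing dimension (that is, packing dimension $1$), and satisfies $\Gamma+\Gamma=\Gamma\cdot\Gamma=\mathbb{R}$. (ii) For any function $\Phi$ with $\Phi(t)\to\infty$ as $t\to\infty$, the set \[ \tilde\Gamma=\left\{\xi\in\mathbb{R}:\ \limsup_{Q\to\infty}\;Q\,\Phi(Q)\min_{q\in\mathbb{Z},\,0<q\le Q}\Vert q\xi\Vert\cdot|q|_S=\infty\right\} \] is a dense $G_\delta$ set, has full packing dimension, and satisfies $\tilde\Gamma+\tilde\Gamma=\tilde\Gamma\cdot\tilde\Gamma=\mathbb{R}$. (iii) If $S$ has singleton complement in the set of primes, i.e. $|S^c|=1$, then for any real number $\xi$ we have \[ \lim_{Q\to\infty}\;Q\min_{q\in\mathbb{Z},\,0<q\le Q}\Vert q\xi\Vert\cdot|q|_S=0. \]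
   Context: $\Vert x\Vert$ denotes the distance from the real number $x$ to the nearest integer. For a nonzero integer $q$ and a prime $p$, $|q|_p=p^{-t}$ where $p^t$ is the exact power of $p$ dividing $q$. For a set $S$ of primes, $|q|_S=\prod_{p\in S}|q|_p$ (well defined also for infinite $S$, since $|q|_p=1$ for all but finitely many $p$). $S^c$ denotes the complement of $S$ within the set of all primes. In (ii), $\Phi:\mathbb{N}\to(0,\infty)$, and $Q$ runs through the positive integers. For $A\subseteq\mathbb{R}$, $A+A=\{a+b:\ a,b\in A\}$ and $A\cdot A=\{ab:\ a,b\in A\}$.
   Formalization: The claims Γ·Γ=ℝ and Γ̃·Γ̃=ℝ are replaced by Γ·Γ=Γ̃·Γ̃=ℝ∖{0}: for ξ=0 the minimum is 0 for every Q, so 0 lies in neither Γ nor Γ̃, and hence 0 is not a product of two elements of either set. *)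

theory Defs
  imports
    "HOL-Analysis.Analysis"
    "HOL-Computational_Algebra.Primes"
    "HOL-Library.Set_Algebras"
begin

definition dist_int :: "real \<Rightarrow> real" where
  "dist_int x = infdist x \<int>"

definition prime_abs :: "nat \<Rightarrow> int \<Rightarrow> real" where
  "prime_abs p q = 1 / real p ^ multiplicity (int p) q"

text \<open>
  The product of all \<open>prime_abs p q\<close> with \<open>p \<in> S\<close>.  The set \<open>S\<close> may be infinite, and \<open>prod\<close>
  over an infinite set is 1 by convention, so the product is restricted to the prime divisors
  of \<open>q\<close> in \<open>S\<close> (a finite set for \<open>q \<noteq> 0\<close>); all other factors are 1.
\<close>
definition S_abs :: "nat set \<Rightarrow> int \<Rightarrow> real" where
  "S_abs S q = (\<Prod>p\<in>{p \<in> S. int p dvd q}. prime_abs p q)"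

text \<open>Meaningful for \<open>Q \<ge> 1\<close> only; the value at \<open>Q = 0\<close> is unspecified.\<close>
definition min_S_dist :: "nat set \<Rightarrow> real \<Rightarrow> nat \<Rightarrow> real" where
  "min_S_dist S \<xi> Q = Min ((\<lambda>q. dist_int (of_int q * \<xi>) * S_abs S q) ` {0<..int Q})"

definition Gamma_set :: "nat set \<Rightarrow> real set" where
  "Gamma_set S = {\<xi>. limsup (\<lambda>Q. ereal (real Q * min_S_dist S \<xi> Q)) = 1}"

definition Gamma_tilde :: "nat set \<Rightarrow> (nat \<Rightarrow> real) \<Rightarrow> real set" where
  "Gamma_tilde S \<Phi> = {\<xi>. limsup (\<lambda>Q. ereal (real Q * \<Phi> Q * min_S_dist S \<xi> Q)) = \<infinity>}"

definition dense_gdelta :: "real set \<Rightarrow> bool" where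
  "dense_gdelta A \<longleftrightarrow> closure A = UNIV \<and> gdelta_in euclidean A"

text \<open>
  The \<open>s\<close>-th power of the diameter of a bounded set, with the usual convention that for \<open>s = 0\<close>
  every nonempty set contributes 1 (whereas \<open>0 powr 0 = 0\<close>) and the empty set contributes 0.
\<close>
definition diam_pow :: "real \<Rightarrow> 'a::metric_space set \<Rightarrow> ennreal" where
  "diam_pow s U = (if U = {} then 0 else if s = 0 then 1 else ennreal (diameter U powr s))"

text \<open>Boundedness is required since \<open>diameter\<close> is unspecified on unbounded sets.\<close>
definition hausdorff_premeasure :: "real \<Rightarrow> real \<Rightarrow> 'a::metric_space set \<Rightarrow> ennreal" where
  "hausdorff_premeasure s \<delta> A =
     (INF U \<in> {U :: nat \<Rightarrow> 'a set. A \<subseteq> (\<Union>i. U i) \<and> (\<forall>i. bounded (U i) \<and> diameter (U i) \<le> \<delta>)}.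
        \<Sum>i. diam_pow s (U i))"

definition hausdorff_measure :: "real \<Rightarrow> 'a::metric_space set \<Rightarrow> ennreal" where
  "hausdorff_measure s A = (SUP \<delta> \<in> {0<..}. hausdorff_premeasure s \<delta> A)"

definition hausdorff_dim :: "'a::metric_space set \<Rightarrow> ereal" where
  "hausdorff_dim A = Inf (ereal ` {s. 0 \<le> s \<and> hausdorff_measure s A = 0})"

text \<open>
  Packings of \<open>A\<close>: countable families of pairwise disjoint closed balls of positive radius at most
  \<open>\<delta>\<close> centred in \<open>A\<close>, represented by the pairs (centre, radius).
\<close>
definition packings :: "real \<Rightarrow> 'a::metric_space set \<Rightarrow> ('a \<times> real) set set" where
  "packings \<delta> A =
     {P. countable P \<and> (\<forall>(x, r) \<in> P. x \<in> A \<and> 0 < r \<and> r \<le> \<delta>) \<and>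
         pairwise (\<lambda>(x, r) (y, t). disjnt (cball x r) (cball y t)) P}"

definition packing_premeasure :: "real \<Rightarrow> 'a::metric_space set \<Rightarrow> ennreal" where
  "packing_premeasure s A =
     (INF \<delta> \<in> {0<..}. SUP P \<in> packings \<delta> A. \<Sum>\<^sub>\<infinity>(x, r)\<in>P. ennreal ((2 * r) powr s))"

text \<open>
  The premeasure is not countably subadditive, hence the additional infimum over countable covers.
\<close>
definition packing_measure :: "real \<Rightarrow> 'a::metric_space set \<Rightarrow> ennreal" where
  "packing_measure s A =
     (INF B \<in> {B :: nat \<Rightarrow> 'a set. A \<subseteq> (\<Union>i. B i)}. \<Sum>i. packing_premeasure s (B i))"

definition packing_dim :: "'a::metric_space set \<Rightarrow> ereal" where
  "packing_dim A = Inf (ereal ` {s. 0 \<le> s \<and> packing_measure s A = 0})"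

text \<open>
  The number 0 lies in neither of the two sets, so their product sets do not contain 0 and are at
  most \<open>UNIV - {0}\<close>.
\<close>
lemma min_S_dist_zero: "Q \<ge> 1 \<Longrightarrow> min_S_dist S 0 Q = 0"
proof -
  assume "Q \<ge> 1"
  then have "{0<..int Q} \<noteq> {}" by auto
  moreover have "infdist (0::real) \<int> = 0" by (rule infdist_zero) simp
  ultimately show ?thesis
    by (simp add: min_S_dist_def dist_int_def image_constant_conv)
qed

lemma limsup_min_S_dist_zero: "limsup (\<lambda>Q. ereal (f Q * min_S_dist S 0 Q)) = 0"
proof -
  have "eventually (\<lambda>Q. ereal (f Q * min_S_dist S 0 Q) = 0) sequentially"
    using eventually_ge_at_top[of 1] by eventually_elim (simp add: min_S_dist_zero zero_ereal_def)
  then have "limsup (\<lambda>Q. ereal (f Q * min_S_dist S 0 Q)) = limsup (\<lambda>Q. 0)"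
    by (rule Limsup_eq)
  then show ?thesis by (simp add: Limsup_const)
qed

lemma zero_notin_Gamma_set_times: "0 \<notin> Gamma_set S * Gamma_set S"
  by (auto simp: Gamma_set_def set_times_def limsup_min_S_dist_zero)

lemma zero_notin_Gamma_tilde_times: "0 \<notin> Gamma_tilde S \<Phi> * Gamma_tilde S \<Phi>"
  by (auto simp: Gamma_tilde_def set_times_def limsup_min_S_dist_zero)

end

theory Submission
  imports Defs
begin

text \<open>
  Write \<open>m\<^sub>Q(\<xi>)\<close> for \<open>min_S_dist S \<xi> Q\<close>.  By Dirichlet's theorem \<open>Q m\<^sub>Q(\<xi>) \<le> 1\<close> always, so all sets in
  question are of the form \<open>{\<xi>. C \<le> limsup f\<^sub>Q(\<xi>)}\<close> with \<open>{f\<^sub>Q > r}\<close> open.  Such a set is a countable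
  intersection of the open sets \<open>\<Union>Q\<ge>N. {f\<^sub>Q > r}\<close>, and it is a dense \<open>G\<^sub>\<delta>\<close> set as soon as each
  of these is dense (Baire, \<open>dense_gdelta_limsup_ge\<close>).  So it suffices to exhibit, in every interval
  and for suitable arbitrarily large \<open>Q\<close>, one point with large \<open>f\<^sub>Q\<close>:

  \<^item> For \<open>S = {p}\<close> take \<open>\<xi> = P/p\<^sup>n\<close> with \<open>p\<close> not dividing \<open>P\<close>, and \<open>Q = p\<^sup>n - 1\<close>.  If \<open>p\<^sup>k\<close> is the
    exact power of \<open>p\<close> in \<open>q \<le> Q\<close>, then \<open>qP/p\<^sup>n\<close> differs from every integer by a nonzero
    multiple of \<open>p\<^sup>k/p\<^sup>n\<close>, and this \<open>p\<^sup>k\<close> compensates \<open>|q|\<^sub>p\<close>; hence \<open>m\<^sub>Q(\<xi>) \<ge> 1/p\<^sup>n\<close>.  The bound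
    survives a perturbation of \<open>\<xi>\<close> that is small compared with \<open>p\<close> to the power \<open>-2n\<close>.

  \<^item> For arbitrary \<open>S\<close> take \<open>\<xi> = a/d + \<eta>\<close> with small \<open>\<eta>\<close>.  For \<open>q\<close> up to about \<open>1/(2d\<eta>)\<close> the distance
    of \<open>q\<xi>\<close> to the integers is at least \<open>q\<eta>\<close>, while \<open>|q|\<^sub>S \<ge> 1/q\<close>; hence \<open>m\<^sub>Q(\<xi>) \<ge> \<eta>\<close> and
    \<open>Q m\<^sub>Q(\<xi>)\<close> is bounded below by a constant that depends on \<open>d\<close> only.  A factor \<open>\<Phi>(Q)\<close> tending
    to infinity turns this into unboundedness.

  The statements on sums, products and packing dimension hold for all dense \<open>G\<^sub>\<delta>\<close> subsets of the
  line.  Two such sets always meet, so \<open>A\<close> meets its images under \<open>y \<mapsto> x - y\<close> and, if \<open>x \<noteq> 0\<close>, \<open>y \<mapsto> x/y\<close>.  If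
  countably many sets cover \<open>A\<close>, one of them is dense in some interval, and a set dense in an
  interval has infinite packing premeasure in all exponents below 1; the proof below stops at the
  lower bound 1, which is enough for the dimension.

  For the Hausdorff dimension, \<open>\<Gamma>\<close> contains the points approximable infinitely often by fractions
  \<open>P/p\<^sup>n\<close> up to \<open>o(1)\<close> times \<open>p\<close> to the power \<open>-2n\<close> (\<open>p_adically_approximable\<close>).  Given a cover
  with small sum of \<open>s\<close>-th powers of diameters, \<open>s < 1/2\<close>, a descending sequence of approximation
  intervals is chosen by averaging so that the sets of the cover that meet the current interval
  \<open>I\<close> have total weight at most \<open>|I|\<^sup>s/8\<close>.  The common point of these intervals is approximable and
  lies in no set of the cover.

  Finally, if a single prime \<open>l\<close> is missing from \<open>S\<close>, then \<open>|q|\<^sub>S = 1/q\<close> for all \<open>q\<close> prime to \<open>l\<close>.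
  Starting from a Dirichlet approximation with denominator \<open>k\<close> one finds an equally useful
  denominator prime to \<open>l\<close> (\<open>exists_multiplier_coprime\<close>) for which \<open>Q m\<^sub>Q(\<xi>) = O(1/k)\<close>, and \<open>k\<close> tends
  to infinity with \<open>Q\<close> if \<open>\<xi>\<close> is irrational.
\<close>

section \<open>Distance to the integers and partial absolute values\<close>

lemma dist_int_le: "dist_int x \<le> \<bar>x - of_int n\<bar>"
  unfolding dist_int_def using infdist_le[of "of_int n" \<int> x] by (simp add: dist_real_def)

lemma dist_int_ge: "(\<And>n. c \<le> \<bar>x - of_int n\<bar>) \<Longrightarrow> c \<le> dist_int x"
  unfolding dist_int_def
  by (subst infdist_notempty) (auto intro!: cINF_greatest simp: dist_real_def Ints_def)

lemma dist_int_Lipschitz: "\<bar>dist_int x - dist_int y\<bar> \<le> \<bar>x - y\<bar>"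
  unfolding dist_int_def using infdist_triangle_abs[of x \<int> y] by (simp add: dist_real_def)

lemma dist_int_nonneg: "0 \<le> dist_int x"
  by (simp add: dist_int_def infdist_nonneg)

lemma dist_int_pos: 
  assumes "x \<notin> \<int>" shows "0 < dist_int x"
proof -
  have "infdist x \<int> \<noteq> 0"
    using assms in_closed_iff_infdist_zero[of "\<int> :: real set" x] by (auto simp: closed_Ints)
  then show ?thesis
    using dist_int_nonneg[of x] by (auto simp: dist_int_def)
qed

lemma continuous_on_dist_int: "continuous_on A f \<Longrightarrow> continuous_on A (\<lambda>x. dist_int (f x))"
  unfolding dist_int_def by (intro continuous_intros)

text \<open>
  The reciprocal of the \<open>S\<close>-part of \<open>q\<close>, written as a subproduct of the prime factorization, so that
  it can be compared with \<open>q\<close> itself.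
\<close>
lemma S_abs_eq:
  assumes "S \<subseteq> {p. prime p}" "q > 0"
  shows "S_abs S q = 1 / of_int (\<Prod>x\<in>{x \<in> prime_factors q. nat x \<in> S}. x ^ multiplicity x q)"
proof -
  have "{x \<in> prime_factors q. nat x \<in> S} = int ` {p \<in> S. int p dvd q}"
  proof (intro equalityI subsetI)
    fix x assume "x \<in> {x \<in> prime_factors q. nat x \<in> S}"
    then have "x = int (nat x)" "nat x \<in> {p \<in> S. int p dvd q}"
      using prime_ge_0_int[of x] by (auto simp: prime_factors_dvd)
    then show "x \<in> int ` {p \<in> S. int p dvd q}" by blast
  qed (use assms in \<open>auto simp: prime_factors_dvd\<close>)
  then show ?thesis
    by (simp add: S_abs_def prime_abs_def prod_dividef prod.reindex)
qed

lemma S_abs_bounds: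
  assumes "S \<subseteq> {p. prime p}" "q > 0"
  shows "0 < S_abs S q" "S_abs S q \<le> 1" "1 / of_int q \<le> S_abs S q"
proof -
  define a where "a = (\<Prod>x\<in>{x \<in> prime_factors q. nat x \<in> S}. x ^ multiplicity x q)"
  have 1: "1 \<le> a"
    unfolding a_def
    by (intro prod_ge_1) (use assms in \<open>auto simp: prime_factors_dvd intro!: one_le_power dest: prime_ge_1_int\<close>)
  have "a \<le> (\<Prod>x\<in>prime_factors q. x ^ multiplicity x q)"
    unfolding a_def
    by (intro prod_mono2) (use assms in \<open>auto simp: prime_factors_dvd intro!: one_le_power dest: prime_ge_1_int\<close>)
  then have "a \<le> q"
    using prime_factorization_int[OF assms(2)] by simp
  with 1 assms show "0 < S_abs S q" "S_abs S q \<le> 1" "1 / of_int q \<le> S_abs S q"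
    unfolding S_abs_eq[OF assms] a_def[symmetric] by (auto simp: field_simps)
qed

lemma S_abs_singleton:
  assumes "prime p"
  shows "S_abs {p} q = 1 / real p ^ multiplicity (int p) q"
proof (cases "int p dvd q")
  case True
  then have "{r \<in> {p}. int r dvd q} = {p}" by auto
  then show ?thesis unfolding S_abs_def by (simp only: prod.insert) (simp add: prime_abs_def)
next
  case False
  then have "{r \<in> {p}. int r dvd q} = {}" by auto
  then show ?thesis
    using False unfolding S_abs_def by (simp only: prod.empty) (simp add: not_dvd_imp_multiplicity_0)
qed

lemma S_abs_coprime_to_complement:
  assumes "S \<subseteq> {p. prime p}" "q > 0" and S: "\<And>p. prime p \<Longrightarrow> int p dvd q \<Longrightarrow> p \<in> S"
  shows "S_abs S q = 1 / of_int q"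
proof -
  have "{x \<in> prime_factors q. nat x \<in> S} = prime_factors q"
    using S assms(2) prime_ge_0_int by (auto simp: prime_factors_dvd)
  then show ?thesis
    using S_abs_eq[OF assms(1,2)] prime_factorization_int[OF assms(2)] by simp
qed

lemma min_S_dist_le:
  "0 < q \<Longrightarrow> q \<le> int Q \<Longrightarrow> min_S_dist S \<xi> Q \<le> dist_int (of_int q * \<xi>) * S_abs S q"
  unfolding min_S_dist_def by (intro Min_le) auto

text \<open>
  Strict lower bounds on the minimum are finitely many strict inequalities between continuous
  functions of \<open>\<xi>\<close>, which makes them open conditions.
\<close>
lemma min_S_dist_greater_iff:
  assumes "Q \<ge> 1"
  shows "c < min_S_dist S \<xi> Q \<longleftrightarrow> (\<forall>q\<in>{0<..int Q}. c < dist_int (of_int q * \<xi>) * S_abs S q)"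
proof -
  have "{0<..int Q} \<noteq> {}" using assms by auto
  then show ?thesis unfolding min_S_dist_def by (subst Min_gr_iff) auto
qed

lemma min_S_dist_ge:
  assumes "Q \<ge> 1" "\<And>q. 0 < q \<Longrightarrow> q \<le> int Q \<Longrightarrow> c \<le> dist_int (of_int q * \<xi>) * S_abs S q"
  shows "c \<le> min_S_dist S \<xi> Q"
proof -
  have "{0<..int Q} \<noteq> {}" using assms by auto
  then show ?thesis unfolding min_S_dist_def using assms by (subst Min_ge_iff) auto
qed

lemma min_S_dist_nonneg:
  assumes "S \<subseteq> {p. prime p}" "Q \<ge> 1" 
  shows "0 \<le> min_S_dist S \<xi> Q"
  using assms by (intro min_S_dist_ge) (auto intro!: mult_nonneg_nonneg dist_int_nonneg less_imp_le[OF S_abs_bounds(1)])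

lemma open_min_S_dist_greater:
  assumes "Q \<ge> 1"
  shows "open {\<xi>. c < min_S_dist S \<xi> Q}"
proof -
  have "{\<xi>. c < min_S_dist S \<xi> Q} =
      (\<Inter>q\<in>{0<..int Q}. {\<xi>. c < dist_int (of_int q * \<xi>) * S_abs S q})"
    using min_S_dist_greater_iff[OF assms] by auto
  also have "open \<dots>"
    by (intro open_INT ballI open_Collect_less) (auto intro!: continuous_intros continuous_on_dist_int)
  finally show ?thesis .
qed

text \<open>
  Dirichlet's theorem already gives this without the factor \<open>S_abs\<close>, which is at most 1.
\<close>
lemma min_S_dist_Dirichlet:
  assumes "S \<subseteq> {p. prime p}" "Q \<ge> 1" 
  shows "real Q * min_S_dist S \<xi> Q \<le> 1"
proof -
  obtain h k where hk: "0 < k" "k \<le> int Q" "\<bar>of_int k * \<xi> - of_int h\<bar> < 1/Q"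
    by (rule Dirichlet_approx[of Q \<xi>]) (use assms in auto)
  have "min_S_dist S \<xi> Q \<le> dist_int (of_int k * \<xi>) * S_abs S k"
    by (rule min_S_dist_le) (use hk in auto)
  also have "\<dots> \<le> dist_int (of_int k * \<xi>) * 1"
    by (intro mult_left_mono S_abs_bounds assms hk dist_int_nonneg)
  also have "\<dots> \<le> 1 / Q"
    using dist_int_le[of "of_int k * \<xi>" h] hk by simp
  finally show ?thesis using assms by (simp add: field_simps)
qed

section \<open>Points where the minimum is large\<close>

text \<open>
  If \<open>q < p ^ n\<close> is exactly divisible by \<open>p ^ k\<close>, then \<open>q * P\<close> is not divisible by \<open>p ^ n\<close> but, like
  \<open>p ^ n\<close> itself, by \<open>p ^ k\<close>.  So \<open>q * P / p ^ n\<close> is at distance at least \<open>p ^ k / p ^ n\<close> from the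
  integers, and the numerator cancels against \<open>S_abs {p} q\<close>.  Replacing \<open>P / p ^ n\<close> by \<open>\<xi>\<close> moves
  \<open>q * \<xi>\<close> by at most \<open>\<delta> / p ^ n\<close>.
\<close>
lemma min_S_dist_near_p_adic:
  assumes p: "prime p" and P: "coprime P (int p)" and n: "n \<ge> 1" and \<delta>: "0 \<le> \<delta>" "\<delta> \<le> 1"
    and \<xi>: "\<bar>\<xi> - of_int P / real p ^ n\<bar> \<le> \<delta> / real p ^ (2 * n)"
  shows "real (p ^ n - 1) * min_S_dist {p} \<xi> (p ^ n - 1) \<ge> (1 - 1 / real p ^ n) * (1 - \<delta>)"
proof -
  define b where "b = real p ^ n"
  have p2: "p \<ge> 2" using p by (rule prime_ge_2_nat)
  have "p ^ 1 \<le> p ^ n" using n p2 by (intro power_increasing) auto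
  then have pn: "p ^ n \<ge> 2" using p2 by simp
  have b0: "b > 0" "b \<ge> 2" using pn p2 by (auto simp: b_def) (metis of_nat_le_iff of_nat_numeral of_nat_power)
  have "(1 - \<delta>) / b \<le> min_S_dist {p} \<xi> (p ^ n - 1)"
  proof (rule min_S_dist_ge)
    fix q :: int assume q: "0 < q" "q \<le> int (p ^ n - 1)"
    then have qn: "q < int p ^ n" using pn by (simp add: of_nat_diff)
    define k where "k = multiplicity (int p) q"
    have kq: "int p ^ k dvd q" by (simp add: k_def multiplicity_dvd)
    then have "int p ^ k \<le> q" using q by (intro zdvd_imp_le)
    then have "int p ^ k < int p ^ n" using qn by linarith
    then have kn: "k < n" using p2 by (simp add: power_less_imp_less_exp)
    have pk: "real p ^ k > 0" using p2 by simp
    have "real p ^ k / b \<le> dist_int (of_int (q * P) / b)"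
    proof (rule dist_int_ge)
      fix j :: int
      have "\<not> int p ^ n dvd q * P"
      proof
        assume "int p ^ n dvd q * P"
        moreover have "coprime (int p ^ n) P" using P by (simp add: coprime_commute)
        ultimately have "int p ^ n dvd q" by (simp add: coprime_dvd_mult_left_iff)
        then show False using zdvd_imp_le q qn by fastforce
      qed
      then have "q * P - j * int p ^ n \<noteq> 0" by (metis dvd_triv_right eq_iff_diff_eq_0)
      moreover have "int p ^ k dvd q * P - j * int p ^ n"
        using kq kn by (intro dvd_diff dvd_mult2 dvd_mult) (auto intro: le_imp_power_dvd)
      ultimately have "int p ^ k \<le> \<bar>q * P - j * int p ^ n\<bar>"
        using dvd_imp_le_int[of "q * P - j * int p ^ n" "int p ^ k"] by simp
      then have "real p ^ k \<le> \<bar>of_int (q * P) - of_int j * b\<bar>"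
        unfolding b_def by (subst (asm) of_int_le_iff[where 'a = real, symmetric]) simp
      also have "of_int (q * P) - of_int j * b = (of_int (q * P) / b - of_int j) * b"
        using b0 by (simp add: field_simps)
      also have "\<bar>\<dots>\<bar> = \<bar>of_int (q * P) / b - of_int j\<bar> * b"
        using b0 by (simp add: abs_mult)
      finally show "real p ^ k / b \<le> \<bar>of_int (q * P) / b - of_int j\<bar>"
        using b0 by (simp add: field_simps)
    qed
    moreover have "\<bar>of_int q * \<xi> - of_int (q * P) / b\<bar> \<le> real p ^ k * \<delta> / b"
    proof -
      have "\<bar>of_int q * \<xi> - of_int (q * P) / b\<bar> = of_int q * \<bar>\<xi> - of_int P / b\<bar>"
      proof -
        have "of_int q * \<xi> - of_int (q * P) / b = of_int q * (\<xi> - of_int P / b)"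
          by (simp add: algebra_simps)
        then show ?thesis using q by (simp add: abs_mult)
      qed
      also have "\<dots> \<le> b * (\<delta> / b ^ 2)"
      proof (intro mult_mono)
        show "real_of_int q \<le> b" using qn unfolding b_def
          by (subst (asm) of_int_less_iff[where 'a = real, symmetric]) simp
        show "\<bar>\<xi> - of_int P / b\<bar> \<le> \<delta> / b\<^sup>2"
          using \<xi> by (simp add: b_def power_mult[symmetric] mult.commute)
      qed (use b0 in auto)
      also have "\<dots> = 1 * \<delta> / b" using b0 by (simp add: power2_eq_square)
      also have "\<dots> \<le> real p ^ k * \<delta> / b"
        using b0 \<delta> p2 by (intro divide_right_mono mult_right_mono one_le_power) auto
      finally show ?thesis .
    qed
    ultimately have "real p ^ k / b - real p ^ k * \<delta> / b \<le> dist_int (of_int q * \<xi>)"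
      using dist_int_Lipschitz[of "of_int q * \<xi>" "of_int (q * P) / b"] by linarith
    then show "(1 - \<delta>) / b \<le> dist_int (of_int q * \<xi>) * S_abs {p} q"
      using pk b0 by (simp add: S_abs_singleton[OF p] k_def[symmetric] field_simps)
  qed (use pn in auto)
  then have "(b - 1) * ((1 - \<delta>) / b) \<le> (b - 1) * min_S_dist {p} \<xi> (p ^ n - 1)"
    using b0 by (intro mult_left_mono) auto
  moreover have "real (p ^ n - 1) = b - 1" using pn by (simp add: b_def of_nat_diff)
  ultimately show ?thesis using b0 by (simp add: b_def[symmetric] field_simps)
qed

text \<open>
  If \<open>q * a / d\<close> is an integer, then \<open>q * \<xi>\<close> exceeds it by \<open>q * \<eta>\<close>, which is at most \<open>1 / (2 * d)\<close>.
  Otherwise \<open>q * a / d\<close> is at distance at least \<open>1 / d\<close> from the integers, and adding \<open>q * \<eta>\<close> uses up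
  at most half of that.  In both cases \<open>q * \<xi>\<close> is at distance at least \<open>q * \<eta>\<close> from the integers, and
  \<open>S_abs S q \<ge> 1 / q\<close> removes the factor \<open>q\<close>.
\<close>
lemma min_S_dist_near_rational:
  assumes S: "S \<subseteq> {p. prime p}" and d: "d > 0" and \<eta>: "\<eta> > 0" and Q: "Q \<ge> 1" "real Q * \<eta> \<le> 1 / (2 * of_int d)"
  shows "\<eta> \<le> min_S_dist S (of_int a / of_int d + \<eta>) Q"
proof (rule min_S_dist_ge)
  fix q :: int assume q: "0 < q" "q \<le> int Q"
  define \<xi> where "\<xi> = of_int a / of_int d + \<eta>"
  have "real_of_int q * \<eta> \<le> real Q * \<eta>" using q \<eta> by (intro mult_right_mono) linarith+
  then have small: "of_int q * \<eta> \<le> 1 / (2 * of_int d)" using Q by linarith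
  have "of_int q * \<eta> \<le> dist_int (of_int q * \<xi>)"
  proof (rule dist_int_ge)
    fix n :: int
    have eq: "of_int q * \<xi> - of_int n = of_int (q * a - n * d) / of_int d + of_int q * \<eta>"
      using d by (simp add: \<xi>_def field_simps)
    show "of_int q * \<eta> \<le> \<bar>of_int q * \<xi> - of_int n\<bar>"
    proof (cases "q * a - n * d = 0")
      case False
      then have "1 \<le> \<bar>q * a - n * d\<bar>" by linarith
      then have "1 \<le> \<bar>real_of_int (q * a - n * d)\<bar>" by linarith
      then have "2 * (1 / (2 * of_int d)) \<le> \<bar>real_of_int (q * a - n * d) / of_int d\<bar>"
        using d by (simp add: abs_divide divide_right_mono)
      moreover have "y \<le> \<bar>x + y\<bar>" if "2 * c \<le> \<bar>x\<bar>" "y \<le> c" for x y c :: real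
        using that by linarith
      ultimately show ?thesis unfolding eq using small by blast
    qed (simp add: eq)
  qed
  then have "of_int q * \<eta> * (1 / of_int q) \<le> dist_int (of_int q * \<xi>) * S_abs S q"
    using q \<eta> by (intro mult_mono S_abs_bounds S dist_int_nonneg) auto
  then show "\<eta> \<le> dist_int (of_int q * (of_int a / of_int d + \<eta>)) * S_abs S q"
    using q by (simp add: \<xi>_def)
qed (rule Q)

section \<open>Only one prime outside the set\<close>

text \<open>
  If \<open>l\<close> does not divide \<open>k\<close>, then \<open>q = k\<close> works.  Otherwise let \<open>q\<close> be the lower entry of a vector
  \<open>(g, q)\<close> that completes \<open>(h, k)\<close> to a unimodular matrix: \<open>q * h - g * k = 1\<close> forces \<open>l\<close> not to divide
  \<open>q\<close>, and \<open>q * \<xi> - g\<close> is of order \<open>1 / k\<close>.  Adding multiples of \<open>(h, k)\<close> brings \<open>q\<close> into the interval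
  from \<open>Q - k\<close> to \<open>Q\<close>, and then dividing by \<open>q \<ge> Q / 2\<close> gains the factor \<open>1 / Q\<close>.
\<close>
lemma exists_multiplier_coprime:
  assumes l: "prime l" and co: "coprime h k" and k: "0 < k" "2 * k \<le> Q" "real_of_int Q > 0"
    and approx: "\<bar>of_int k * \<xi> - of_int h\<bar> \<le> 4 / of_int Q"
  shows "\<exists>q. 0 < q \<and> q \<le> Q \<and> \<not> l dvd q \<and> of_int Q * dist_int (of_int q * \<xi>) / of_int q \<le> 10 / of_int k"
proof (cases "l dvd k")
  case False
  have "dist_int (of_int k * \<xi>) \<le> 4 / of_int Q"
    using dist_int_le[of "of_int k * \<xi>" h] approx by simp
  then have "of_int Q * dist_int (of_int k * \<xi>) \<le> 4" using k by (simp add: field_simps)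
  then have "of_int Q * dist_int (of_int k * \<xi>) / of_int k \<le> 10 / of_int k"
    using k by (intro divide_right_mono) auto
  then show ?thesis using False k by (intro exI[of _ k]) auto
next
  case True
  obtain u v where uv: "u * h + v * k = 1"
    using bezout_int[of h k] co by (auto simp: coprime_iff_gcd_eq_1)
  define t where "t = (Q - u) div k"
  define q where "q = u + t * k"
  define g where "g = t * h - v"
  have det: "q * h - g * k = 1" using uv by (simp add: q_def g_def algebra_simps)
  have "Q - q = (Q - u) mod k" by (simp add: q_def t_def minus_div_mult_eq_mod[symmetric])
  then have q: "q \<le> Q" "Q - k < q"
    using pos_mod_bound[of k "Q - u"] pos_mod_sign[of k "Q - u"] k by linarith+
  then have q2: "Q \<le> 2 * q" "0 < q" using k by auto
  have nd: "\<not> l dvd q"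
  proof
    assume "l dvd q"
    then have "l dvd q * h - g * k" using True by (intro dvd_diff) auto
    then show False using det l by (simp add: not_prime_unit)
  qed
  have "real_of_int q * of_int h - of_int g * of_int k = 1"
    using arg_cong[OF det, of real_of_int] by simp
  then have "of_int q * \<xi> - of_int g = (of_int q * (of_int k * \<xi> - of_int h) + 1) / of_int k"
    using k by (simp add: field_simps)
  then have "\<bar>of_int q * \<xi> - of_int g\<bar> = \<bar>of_int q * (of_int k * \<xi> - of_int h) + 1\<bar> / of_int k"
    using k by (simp add: abs_divide)
  also have "\<dots> \<le> 5 / of_int k"
  proof (intro divide_right_mono)
    have "\<bar>of_int q * (of_int k * \<xi> - of_int h)\<bar> \<le> of_int Q * (4 / of_int Q)"
      unfolding abs_mult using q q2 approx by (intro mult_mono) auto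
    then show "\<bar>of_int q * (of_int k * \<xi> - of_int h) + 1\<bar> \<le> 5" using k by simp
  qed (use k in auto)
  finally have "dist_int (of_int q * \<xi>) \<le> 5 / of_int k"
    using dist_int_le[of "of_int q * \<xi>" g] by linarith
  then have "of_int Q * dist_int (of_int q * \<xi>) \<le> (2 * of_int q) * (5 / of_int k)"
    using q2 k dist_int_nonneg by (intro mult_mono) auto
  then have "of_int Q * dist_int (of_int q * \<xi>) / of_int q \<le> 10 / of_int k"
    using q2 by (simp add: field_simps)
  then show ?thesis using q q2 nd by blast
qed

text \<open>
  If some \<open>q * \<xi>\<close> is an integer, the minimum is eventually 0.  Otherwise the finitely many positive \<open>k \<le> K\<close>
  have \<open>dist_int (k * \<xi>)\<close> bounded away from 0, so that Dirichlet approximations for large \<open>Q\<close> have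
  denominator \<open>k > K\<close>, which makes the bound \<open>10 / k\<close> small.
\<close>
lemma min_S_dist_tendsto_0:
  assumes card: "card ({p. prime p} - S) = 1" and S: "S \<subseteq> {p. prime p}"
  shows "(\<lambda>Q. real Q * min_S_dist S \<xi> Q) \<longlonglongrightarrow> 0"
proof -
  obtain l where l: "{p. prime p} - S = {l}" using card by (auto simp: card_1_singleton_iff)
  then have lp: "prime l" by blast
  have nonneg: "\<forall>\<^sub>F Q in sequentially. 0 \<le> real Q * min_S_dist S \<xi> Q"
    using eventually_ge_at_top[of 1] by eventually_elim (simp add: min_S_dist_nonneg[OF S])
  have "\<forall>\<^sub>F Q in sequentially. real Q * min_S_dist S \<xi> Q < e" if e: "e > 0" for e
  proof (cases "\<exists>q>0. of_int q * \<xi> \<in> \<int>")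
    case True
    then obtain q where q: "q > 0" "of_int q * \<xi> \<in> \<int>" by auto
    then have d0: "dist_int (of_int q * \<xi>) = 0" by (simp add: dist_int_def)
    show ?thesis using eventually_ge_at_top[of "nat q"]
    proof eventually_elim
      case (elim Q)
      then have "min_S_dist S \<xi> Q \<le> 0"
        using min_S_dist_le[of q Q S \<xi>] d0 q by auto
      then have "real Q * min_S_dist S \<xi> Q \<le> 0" by (simp add: mult_nonneg_nonpos)
      then show ?case using e by linarith
    qed
  next
    case False
    obtain K :: nat where K: "10 / e < real K" using reals_Archimedean2 by blast
    have K0: "K > 0" using K e by (cases K) (auto simp: divide_less_0_iff)
    define c where "c = Min ((\<lambda>q. dist_int (of_int q * \<xi>)) ` {0<..int K})"
    have "c > 0" unfolding c_def using False K0 by (subst Min_gr_iff) (auto intro!: dist_int_pos)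
    then obtain R :: nat where R: "4 / c < real R" using reals_Archimedean2 by blast
    show ?thesis using eventually_ge_at_top[of "max R 2"]
    proof eventually_elim
      case (elim Q)
      then have Q2: "Q \<ge> 2" and QR: "real R \<le> real Q" by auto
      \<comment> \<open>Dirichlet is applied with \<open>Q div 2\<close>, so that \<open>2 * k \<le> Q\<close>; the price is the constant 4.\<close>
      obtain h k where hk: "coprime h k" "0 < k" "k \<le> int (Q div 2)"
          "\<bar>of_int k * \<xi> - of_int h\<bar> < 1 / real (Q div 2)"
        by (rule Dirichlet_approx_coprime[of "Q div 2" \<xi>]) (use Q2 in auto)
      have "real Q \<le> 4 * real (Q div 2)" using Q2 by linarith
      then have "1 / real (Q div 2) \<le> 4 / real Q" using Q2 by (simp add: field_simps)
      then have hk4: "\<bar>of_int k * \<xi> - of_int h\<bar> \<le> 4 / real Q" using hk by linarith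
      have "k > int K"
      proof (rule ccontr)
        assume "\<not> k > int K"
        then have "c \<le> dist_int (of_int k * \<xi>)" unfolding c_def using hk by (intro Min_le) auto
        also have "\<dots> \<le> 4 / real Q" using dist_int_le[of "of_int k * \<xi>" h] hk4 by linarith
        finally have "real Q \<le> 4 / c" using \<open>c > 0\<close> Q2 by (simp add: field_simps)
        then show False using R QR by linarith
      qed
      then have kK: "real K < of_int k" by linarith
      obtain q where q: "0 < q" "q \<le> int Q" "\<not> int l dvd q"
         "of_int (int Q) * dist_int (of_int q * \<xi>) / of_int q \<le> 10 / of_int k"
      proof -
        have "2 * k \<le> int Q" using hk(3) by linarith
        then show thesis
          using exists_multiplier_coprime[of "int l" h k "int Q" \<xi>] lp hk(1,2) hk4 Q2 that by auto
      qed
      have "S_abs S q = 1 / of_int q"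
        using q(1,3) l S by (intro S_abs_coprime_to_complement) auto
      then have "real Q * min_S_dist S \<xi> Q \<le> real Q * (dist_int (of_int q * \<xi>) * (1 / of_int q))"
        using min_S_dist_le[of q Q S \<xi>] q by (intro mult_left_mono) auto
      also have "\<dots> \<le> 10 / of_int k" using q by simp
      also have "\<dots> < e" using less_trans[OF K kK] kK e by (simp add: field_simps)
      finally show ?case .
    qed
  qed
  then show ?thesis
    by (intro order_tendstoI) (auto intro: eventually_mono[OF nonneg])
qed

section \<open>Dense sets of type \<open>G\<^sub>\<delta>\<close> on the real line\<close>

text \<open>
  From left to right, a superset of a dense set is dense; from right to left, this is the Baire
  category theorem.
\<close>
lemma dense_gdelta_iff:
  "dense_gdelta A \<longleftrightarrow>
    (\<exists>\<G>. countable \<G> \<and> (\<forall>G\<in>\<G>. open G \<and> closure G = UNIV) \<and> A = \<Inter>\<G>)"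
proof
  assume A: "dense_gdelta A"
  then obtain \<G> where \<G>: "countable \<G>" "\<forall>G\<in>\<G>. open G" "A = \<Inter>\<G>"
    by (auto simp: dense_gdelta_def gdelta_in_alt intersection_of_def)
  have "closure G = UNIV" if "G \<in> \<G>" for G
  proof -
    have "closure A \<subseteq> closure G" using that \<G> by (intro closure_mono) auto
    then show ?thesis using A by (auto simp: dense_gdelta_def)
  qed
  with \<G> show "\<exists>\<G>. countable \<G> \<and> (\<forall>G\<in>\<G>. open G \<and> closure G = UNIV) \<and> A = \<Inter>\<G>" by blast
next
  assume "\<exists>\<G>. countable \<G> \<and> (\<forall>G\<in>\<G>. open G \<and> closure G = UNIV) \<and> A = \<Inter>\<G>"
  then obtain \<G> where \<G>: "countable \<G>" "\<forall>G\<in>\<G>. open G \<and> closure G = UNIV" "A = \<Inter>\<G>" by auto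
  have "UNIV \<subseteq> closure (\<Inter>\<G>)" by (rule Baire) (use \<G> in auto)
  then show "dense_gdelta A"
    using \<G> by (auto simp: dense_gdelta_def gdelta_in_alt intersection_of_def)
qed

lemma dense_gdelta_Inter:
  assumes "countable \<A>" "\<And>A. A \<in> \<A> \<Longrightarrow> dense_gdelta A"
  shows "dense_gdelta (\<Inter>\<A>)"
proof -
  have "\<forall>A\<in>\<A>. \<exists>\<G>. countable \<G> \<and> (\<forall>G\<in>\<G>. open G \<and> closure G = UNIV) \<and> A = \<Inter>\<G>"
    using assms(2) dense_gdelta_iff by blast
  then obtain \<G> where \<G>: "\<And>A. A \<in> \<A> \<Longrightarrow> countable (\<G> A)" 
      "\<And>A G. A \<in> \<A> \<Longrightarrow> G \<in> \<G> A \<Longrightarrow> open G \<and> closure G = UNIV"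
      "\<And>A. A \<in> \<A> \<Longrightarrow> A = \<Inter>(\<G> A)"
    by metis
  have "\<Inter>\<A> = \<Inter>(\<Union>A\<in>\<A>. \<G> A)" using \<G>(3) by blast
  moreover have "countable (\<Union>A\<in>\<A>. \<G> A)" using assms(1) \<G>(1) by (intro countable_UN) auto
  ultimately show ?thesis unfolding dense_gdelta_iff using \<G>(2) 
    by (intro exI[of _ "\<Union>A\<in>\<A>. \<G> A"]) auto
qed

lemma dense_gdelta_open: "open G \<Longrightarrow> closure G = UNIV \<Longrightarrow> dense_gdelta G"
  unfolding dense_gdelta_iff by (intro exI[of _ "{G}"]) auto

lemma dense_gdelta_nonempty: "dense_gdelta A \<Longrightarrow> A \<noteq> {}"
  by (auto simp: dense_gdelta_def)

lemma closure_eq_UNIV_iff: "closure A = UNIV \<longleftrightarrow> (\<forall>V. open V \<and> V \<noteq> {} \<longrightarrow> V \<inter> A \<noteq> {})"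
  for A :: "'a :: topological_space set"
proof -
  have "closure A = UNIV \<longleftrightarrow> interior (- A) = {}" by (auto simp: closure_interior)
  also have "\<dots> \<longleftrightarrow> (\<forall>V. open V \<and> V \<subseteq> - A \<longrightarrow> V = {})"
    using interior_maximal open_interior interior_subset by (metis subset_empty)
  finally show ?thesis by (simp add: disjoint_eq_subset_Compl) blast
qed

text \<open>
  Rational thresholds are enough, and there are only countably many of them.
\<close>
lemma le_limsup_iff_rat:
  fixes f :: "nat \<Rightarrow> real" and C :: ereal
  shows "C \<le> limsup (\<lambda>Q. ereal (f Q)) \<longleftrightarrow>
    (\<forall>r. ereal (of_rat r) < C \<longrightarrow> (\<forall>N. \<exists>Q\<ge>N. of_rat r < f Q))"
proof (intro iffI allI impI)
  fix r N assume "C \<le> limsup (\<lambda>Q. ereal (f Q))" "ereal (of_rat r) < C"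
  then have "ereal (of_rat r) < limsup (\<lambda>Q. ereal (f Q))" by simp
  then have "\<exists>\<^sub>F Q in sequentially. ereal (of_rat r) < ereal (f Q)"
    using Limsup_bounded[where X = "\<lambda>Q. ereal (f Q)" and C = "ereal (of_rat r)" and F = sequentially]
    unfolding frequently_def not_less by (meson not_le)
  then show "\<exists>Q\<ge>N. of_rat r < f Q" by (auto simp: frequently_sequentially)
next
  assume r: "\<forall>r. ereal (of_rat r) < C \<longrightarrow> (\<forall>N. \<exists>Q\<ge>N. of_rat r < f Q)"
  show "C \<le> limsup (\<lambda>Q. ereal (f Q))"
  proof (rule ccontr)
    assume "\<not> C \<le> limsup (\<lambda>Q. ereal (f Q))"
    then obtain q where q: "limsup (\<lambda>Q. ereal (f Q)) < ereal (of_rat q)" "ereal (of_rat q) < C"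
      using ereal_dense3[of "limsup (\<lambda>Q. ereal (f Q))" C] by (auto simp: not_le)
    have "\<forall>\<^sub>F Q in sequentially. f Q < of_rat q"
      using Limsup_lessD[OF q(1)] by simp
    then obtain N where N: "\<And>Q. Q \<ge> N \<Longrightarrow> f Q < of_rat q" by (auto simp: eventually_sequentially)
    obtain Q where "Q \<ge> N" "of_rat q < f Q" using r q(2) by blast
    then show False using N[of Q] by linarith
  qed
qed

lemma dense_gdelta_limsup_ge:
  fixes f :: "nat \<Rightarrow> real \<Rightarrow> real" and C :: ereal
  assumes "open": "\<And>Q r. Q \<ge> 1 \<Longrightarrow> open {x. r < f Q x}"
    and dense: "\<And>r N V. ereal r < C \<Longrightarrow> open V \<Longrightarrow> V \<noteq> {} \<Longrightarrow> \<exists>Q\<ge>N. \<exists>x\<in>V. r < f Q x"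
  shows "dense_gdelta {x. C \<le> limsup (\<lambda>Q. ereal (f Q x))}"
proof -
  define E where "E z = (\<Union>Q\<in>{Suc (snd z)..}. {x. of_rat (fst z) < f Q x})" for z
  define I where "I = {z :: rat \<times> nat. ereal (of_rat (fst z)) < C}"
  have "dense_gdelta (E z)" if z: "z \<in> I" for z
  proof (rule dense_gdelta_open)
    show "open (E z)" unfolding E_def using "open" by (intro open_UN) auto
    show "closure (E z) = UNIV"
      unfolding closure_eq_UNIV_iff
    proof (intro allI impI)
      fix V :: "real set" assume "open V \<and> V \<noteq> {}"
      then obtain Q x where "Q \<ge> Suc (snd z)" "x \<in> V" "of_rat (fst z) < f Q x"
        using dense[of "of_rat (fst z)" V "Suc (snd z)"] z unfolding I_def by blast
      then show "V \<inter> E z \<noteq> {}" unfolding E_def by blast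
    qed
  qed
  then have "dense_gdelta (\<Inter>(E ` I))"
    by (intro dense_gdelta_Inter) auto
  also have "\<Inter>(E ` I) = {x. C \<le> limsup (\<lambda>Q. ereal (f Q x))}"
  proof (intro equalityI subsetI CollectI)
    fix x assume x: "x \<in> \<Inter>(E ` I)"
    show "C \<le> limsup (\<lambda>Q. ereal (f Q x))"
      unfolding le_limsup_iff_rat
    proof (intro allI impI)
      fix r N assume "ereal (of_rat r) < C"
      then have "x \<in> E (r, N)" using x by (auto simp: I_def)
      then show "\<exists>Q\<ge>N. of_rat r < f Q x" by (auto simp: E_def intro: Suc_leD)
    qed
  next
    fix x assume "x \<in> {x. C \<le> limsup (\<lambda>Q. ereal (f Q x))}"
    then have r: "\<exists>Q\<ge>N. of_rat r < f Q x" if "ereal (of_rat r) < C" for r N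
      using that unfolding mem_Collect_eq le_limsup_iff_rat by blast
    have "x \<in> E z" if "z \<in> I" for z
      using r[of "fst z" "Suc (snd z)"] that unfolding E_def I_def by auto
    then show "x \<in> \<Inter>(E ` I)" by blast
  qed
  finally show ?thesis .
qed

text \<open>
  The involution \<open>\<phi>\<close> is a homeomorphism of \<open>D\<close>, so preimages of dense open sets under it are again
  dense and open in \<open>D\<close>; hence \<open>A\<close> and its preimage are both dense \<open>G\<^sub>\<delta>\<close> sets.  The maps \<open>y \<mapsto> x - y\<close>
  and \<open>y \<mapsto> x / y\<close> are the instances that are needed.
\<close>
lemma dense_gdelta_meets_involution_image:
  fixes \<phi> :: "real \<Rightarrow> real"
  assumes A: "dense_gdelta A" and D: "open D" "closure D = UNIV"
    and cont: "continuous_on D \<phi>" and maps: "\<phi> ` D \<subseteq> D" and inv: "\<And>y. y \<in> D \<Longrightarrow> \<phi> (\<phi> y) = y"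
  shows "\<exists>y\<in>D. y \<in> A \<and> \<phi> y \<in> A"
proof -
  obtain \<G> where \<G>: "countable \<G>" "\<And>G. G \<in> \<G> \<Longrightarrow> open G \<and> closure G = UNIV" "A = \<Inter>\<G>"
    using A unfolding dense_gdelta_iff by blast
  have pre: "open (D \<inter> \<phi> -` G)" if "open G" for G
    using continuous_on_open_vimage[OF D(1), of \<phi>] cont that by (simp add: Int_commute)
  have "dense_gdelta (D \<inter> \<phi> -` G)" if "G \<in> \<G>" for G
  proof (rule dense_gdelta_open)
    show "open (D \<inter> \<phi> -` G)" using pre \<G>(2) that by simp
    show "closure (D \<inter> \<phi> -` G) = UNIV"
      unfolding closure_eq_UNIV_iff
    proof (intro allI impI)
      fix V :: "real set" assume V: "open V \<and> V \<noteq> {}"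
      then have "V \<inter> D \<noteq> {}" using D(2) unfolding closure_eq_UNIV_iff by blast
      then obtain v where v: "v \<in> V" "v \<in> D" by blast
      have "\<phi> v \<in> D \<inter> \<phi> -` V" using v maps inv by auto
      moreover have "open (D \<inter> \<phi> -` V)" using pre V by simp
      moreover have "closure G = UNIV" using \<G>(2) that by simp
      ultimately obtain y where "y \<in> D \<inter> \<phi> -` V" "y \<in> G"
        unfolding closure_eq_UNIV_iff by blast
      then have "\<phi> y \<in> V \<inter> (D \<inter> \<phi> -` G)" using maps inv by auto
      then show "V \<inter> (D \<inter> \<phi> -` G) \<noteq> {}" by blast
    qed
  qed
  then have "dense_gdelta (\<Inter>({A, D} \<union> (\<lambda>G. D \<inter> \<phi> -` G) ` \<G>))"
    using A \<G>(1) dense_gdelta_open[OF D] by (intro dense_gdelta_Inter) auto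
  then obtain y where y: "y \<in> \<Inter>({A, D} \<union> (\<lambda>G. D \<inter> \<phi> -` G) ` \<G>)"
    using dense_gdelta_nonempty by blast
  have "y \<in> D \<inter> \<phi> -` G" if "G \<in> \<G>" for G
    using that by (intro InterD[OF y]) auto
  then have "\<phi> y \<in> A" using \<G>(3) by auto
  moreover have "y \<in> A" "y \<in> D" using y by auto
  ultimately show ?thesis by blast
qed

lemma dense_gdelta_plus: "dense_gdelta A \<Longrightarrow> A + A = UNIV"
proof (intro equalityI subsetI UNIV_I)
  fix x :: real assume A: "dense_gdelta A"
  have "\<exists>y\<in>UNIV. y \<in> A \<and> x - y \<in> A"
    by (rule dense_gdelta_meets_involution_image[OF A]) (auto intro!: continuous_intros)
  then obtain y where "y \<in> A" "x - y \<in> A" by blast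
  then show "x \<in> A + A" using set_plus_intro[of y A "x - y" A] by simp
qed

lemma dense_gdelta_times: 
  assumes "dense_gdelta A" "0 \<notin> A * A"
  shows "A * A = UNIV - {0}"
proof (intro equalityI subsetI)
  fix x :: real assume x: "x \<in> UNIV - {0}"
  have "\<exists>y\<in>- {0}. y \<in> A \<and> x / y \<in> A"
    by (rule dense_gdelta_meets_involution_image[OF assms(1)])
      (use x in \<open>auto simp: closure_complement intro!: continuous_intros\<close>)
  then obtain y where "y \<noteq> 0" "y \<in> A" "x / y \<in> A" by blast
  then show "x \<in> A * A" using set_times_intro[of y A "x / y" A] by simp
qed (use assms in auto)

section \<open>Packing dimension of dense \<open>G\<^sub>\<delta>\<close> sets\<close>

text \<open>
  Compare Lebesgue measures of the disjoint balls and of the interval.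
\<close>
lemma sum_radii_packing_le:
  fixes P :: "(real \<times> real) set"
  assumes fin: "finite P" and sub: "\<And>x r. (x, r) \<in> P \<Longrightarrow> 0 < r \<and> cball x r \<subseteq> {a..b}"
    and disj: "pairwise (\<lambda>(x, r) (y, t). disjnt (cball x r) (cball y t)) P" and ab: "a \<le> b"
  shows "(\<Sum>(x, r)\<in>P. 2 * r) \<le> b - a"
proof -
  let ?B = "\<lambda>(x, r). cball x (r::real)"
  have "measure lborel (cball x r) = 2 * r" if "(x, r) \<in> P" for x r
    using sub[OF that] by (simp add: cball_eq_atLeastAtMost)
  then have "(\<Sum>(x, r)\<in>P. 2 * r) = (\<Sum>p\<in>P. measure lborel (?B p))"
    by (intro sum.cong) auto
  also have "\<dots> = measure lborel (\<Union>p\<in>P. ?B p)"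
  proof (rule measure_finite_Union[symmetric])
    show "disjoint_family_on ?B P"
      using disj by (fastforce simp: disjoint_family_on_def pairwise_def disjnt_def)
  qed (use fin in \<open>auto simp: cball_eq_atLeastAtMost emeasure_lborel_Icc_eq\<close>)
  also have "\<dots> \<le> measure lborel {a..b}"
    by (intro measure_mono_fmeasurable) (use sub fin in \<open>auto simp: fmeasurable_def emeasure_lborel_Icc_eq\<close>)
  finally show ?thesis using ab by simp
qed

text \<open>
  For balls of radius at most \<open>\<delta>\<close> the sum of \<open>(2 * r) powr s\<close> is at most \<open>(2 * \<delta>) powr (s - 1)\<close> times
  the total length of the balls, which is bounded; the factor tends to 0 with \<open>\<delta>\<close>.
\<close>
lemma packing_premeasure_bounded_eq_0:
  fixes B :: "real set"
  assumes s: "s > 1" and B: "B \<subseteq> {a..b}" and ab: "a \<le> b"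
  shows "packing_premeasure s B = 0"
proof -
  have le: "packing_premeasure s B \<le> ennreal ((2 * \<delta>) powr (s - 1) * (b - a + 2 * \<delta>))" if \<delta>: "\<delta> > 0" for \<delta>
    unfolding packing_premeasure_def
  proof (rule INF_lower2[where i=\<delta>])
    show "(SUP P\<in>packings \<delta> B. \<Sum>\<^sub>\<infinity>(x, r)\<in>P. ennreal ((2 * r) powr s))
      \<le> ennreal ((2 * \<delta>) powr (s - 1) * (b - a + 2 * \<delta>))"
    proof (rule SUP_least)
      fix P assume P: "P \<in> packings \<delta> B"
      show "(\<Sum>\<^sub>\<infinity>(x, r)\<in>P. ennreal ((2 * r) powr s)) \<le> ennreal ((2 * \<delta>) powr (s - 1) * (b - a + 2 * \<delta>))"
      proof (rule infsum_le_finite_sums[OF nonneg_summable_on_complete])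
        fix F assume F: "finite F" "F \<subseteq> P"
        have Fr: "x \<in> B" "0 < r" "r \<le> \<delta>" if "(x, r) \<in> F" for x r
          using P F that by (auto simp: packings_def)
        have "(\<Sum>(x, r)\<in>F. (2 * r) powr s) \<le> (\<Sum>(x, r)\<in>F. (2 * \<delta>) powr (s - 1) * (2 * r))"
        proof (intro sum_mono, safe)
          fix x r assume "(x, r) \<in> F"
          note r = Fr[OF this]
          have "(2 * r) powr s = (2 * r) powr (s - 1) * (2 * r)"
            using r by (simp add: powr_diff)
          also have "\<dots> \<le> (2 * \<delta>) powr (s - 1) * (2 * r)"
            using r s by (intro mult_right_mono powr_mono2) auto
          finally show "(2 * r) powr s \<le> (2 * \<delta>) powr (s - 1) * (2 * r)" .
        qed
        also have "\<dots> = (2 * \<delta>) powr (s - 1) * (\<Sum>(x, r)\<in>F. 2 * r)"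
          by (simp add: sum_distrib_left case_prod_beta)
        also have "\<dots> \<le> (2 * \<delta>) powr (s - 1) * ((b + \<delta>) - (a - \<delta>))"
        proof (intro mult_left_mono sum_radii_packing_le)
          show "pairwise (\<lambda>(x, r) (y, t). disjnt (cball x r) (cball y t)) F"
            using P F by (auto simp: packings_def intro: pairwise_subset)
          show "0 < r \<and> cball x r \<subseteq> {a - \<delta>..b + \<delta>}" if "(x, r) \<in> F" for x r
            using Fr[OF that] B by (force simp: cball_eq_atLeastAtMost)
        qed (use F \<delta> ab in auto)
        finally have "(\<Sum>(x, r)\<in>F. (2 * r) powr s) \<le> (2 * \<delta>) powr (s - 1) * (b - a + 2 * \<delta>)"
          by (simp add: algebra_simps)
        then have "ennreal (\<Sum>(x, r)\<in>F. (2 * r) powr s) \<le> ennreal ((2 * \<delta>) powr (s - 1) * (b - a + 2 * \<delta>))"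
          by (rule ennreal_leI)
        then show "(\<Sum>(x, r)\<in>F. ennreal ((2 * r) powr s)) \<le> ennreal ((2 * \<delta>) powr (s - 1) * (b - a + 2 * \<delta>))"
          by (simp add: case_prod_beta sum_ennreal)
      qed simp
    qed
  qed (use \<delta> in auto)
  have "((\<lambda>\<delta>. ennreal ((2 * \<delta>) powr (s - 1) * (b - a + 2 * \<delta>))) \<longlongrightarrow> ennreal (0 * (b - a + 2 * 0))) (at_right 0)"
  proof (intro tendsto_ennrealI tendsto_mult tendsto_intros)
    have "((\<lambda>\<delta>::real. (2 * \<delta>) powr (s - 1)) \<longlongrightarrow> (2 * 0) powr (s - 1)) (at_right 0)"
      using s by (intro tendsto_powr' tendsto_intros) (auto simp: eventually_at_filter)
    then show "((\<lambda>\<delta>::real. (2 * \<delta>) powr (s - 1)) \<longlongrightarrow> 0) (at_right 0)" by simp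
  qed
  moreover have "\<forall>\<^sub>F \<delta> in at_right 0. packing_premeasure s B \<le> ennreal ((2 * \<delta>) powr (s - 1) * (b - a + 2 * \<delta>))"
    using le eventually_at_right_less[of "0::real"] by (auto elim: eventually_mono)
  ultimately have "packing_premeasure s B \<le> ennreal (0 * (b - a + 2 * 0))"
    by (intro tendsto_lowerbound[where F = "at_right (0::real)"]) auto
  then show ?thesis by simp
qed

lemma packing_measure_eq_0:
  fixes A :: "real set"
  assumes "s > 1" shows "packing_measure s A = 0"
proof -
  have "packing_measure s A \<le> (\<Sum>i. packing_premeasure s {- real i..real i})"
    unfolding packing_measure_def
  proof (rule INF_lower, safe)
    fix x :: real
    obtain i :: nat where "\<bar>x\<bar> \<le> real i" using real_arch_simple by blast
    then show "x \<in> (\<Union>i. {- real i..real i})" by (intro UN_I[of i]) auto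
  qed
  also have "\<dots> = 0" using packing_premeasure_bounded_eq_0[OF assms order_refl] by simp
  finally show ?thesis by simp
qed

text \<open>
  Cut the interval of length \<open>l\<close> into \<open>N\<close> equal cells and put a ball of half the cell's length, centred
  in \<open>B\<close>, near the midpoint of each.  The sum of the \<open>s\<close>-th powers of the diameters is
  \<open>N powr (1 - s) * (l / 2) powr s\<close>, which is as large as one likes for \<open>s < 1\<close>.
\<close>
lemma packing_premeasure_somewhere_dense:
  fixes B :: "real set"
  assumes s: "0 \<le> s" "s < 1" and uv: "u < v" "{u<..<v} \<subseteq> closure B"
  shows "1 \<le> packing_premeasure s B"
  unfolding packing_premeasure_def
proof (rule INF_greatest)
  fix \<delta> :: real assume \<delta>: "\<delta> \<in> {0<..}"
  define l where "l = v - u"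
  have l: "l > 0" using uv by (simp add: l_def)
  define X where "X = 1 / (l / 2) powr s"
  have X: "X > 0" using l by (simp add: X_def)
  obtain N :: nat where N': "max (max (X powr (1 / (1 - s))) (l / \<delta>)) 1 \<le> real N"
    using real_arch_simple by blast
  have "X = (X powr (1 / (1 - s))) powr (1 - s)" using X s by (simp add: powr_powr)
  also have "\<dots> \<le> real N powr (1 - s)" using N' s by (intro powr_mono2) auto
  finally have N: "1 \<le> real N powr (1 - s) * (l / 2) powr s" "l / \<delta> \<le> real N" "N \<ge> 1"
    using N' l by (auto simp: X_def field_simps)
  define h where "h = l / N"
  have h: "h > 0" using l N by (simp add: h_def)
  have "h \<le> \<delta>" using N \<delta> l by (simp add: h_def field_simps)
  \<comment> \<open>Centres deviate from the cell midpoints by less than \<open>h / 8\<close>, so they are more than \<open>3 * h / 4\<close> apart and balls of radius \<open>h / 4\<close> are disjoint.\<close>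
  have "\<exists>x\<in>B. \<bar>x - (u + (real k + 1 / 2) * h)\<bar> < h / 8" if "k < N" for k
  proof -
    have "(real k + 1 / 2) * h < real N * h" using that h by (intro mult_strict_right_mono) auto
    then have "u + (real k + 1 / 2) * h < v" using N(3) by (simp add: h_def l_def)
    moreover have "0 < (real k + 1 / 2) * h" using h by (intro mult_pos_pos) auto
    ultimately have "u + (real k + 1 / 2) * h \<in> closure B" using uv(2) by auto
    then have "\<forall>e>0. \<exists>x\<in>B. dist x (u + (real k + 1 / 2) * h) < e" by (simp add: closure_approachable)
    moreover have "h / 8 > 0" using h by simp
    ultimately show ?thesis unfolding dist_real_def by blast
  qed
  then obtain x where x: "\<And>k. k < N \<Longrightarrow> x k \<in> B" 
      "\<And>k. k < N \<Longrightarrow> \<bar>x k - (u + (real k + 1 / 2) * h)\<bar> < h / 8"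
    by metis
  have sep: "x j + 3 / 4 * h < x k" if "j < k" "k < N" for j k
  proof -
    have "(real j + 1) * h \<le> real k * h" using that h by (intro mult_right_mono) auto
    moreover have "\<bar>x j - (u + (real j + 1 / 2) * h)\<bar> < h / 8" "\<bar>x k - (u + (real k + 1 / 2) * h)\<bar> < h / 8"
      using x(2) that by auto
    ultimately show ?thesis unfolding distrib_right abs_less_iff by linarith
  qed
  then have sep': "3 / 4 * h < \<bar>x j - x k\<bar>" if "j \<noteq> k" "j < N" "k < N" for j k
  proof (cases "j < k")
    case True
    then show ?thesis using sep[of j k] that by linarith
  next
    case False
    then show ?thesis using sep[of k j] that by linarith
  qed
  define P where "P = (\<lambda>k. (x k, h / 4)) ` {..<N}"
  have inj: "inj_on (\<lambda>k. (x k, h / 4)) {..<N}"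
  proof (intro inj_onI)
    fix j k assume "j \<in> {..<N}" "k \<in> {..<N}" "(x j, h / 4) = (x k, h / 4)"
    then show "j = k" using sep'[of j k] h by (cases "j = k") auto
  qed
  have "P \<in> packings \<delta> B"
    unfolding packings_def
  proof (intro CollectI conjI)
    show "pairwise (\<lambda>(x, r) (y, t). disjnt (cball x r) (cball y t)) P"
    proof (clarsimp simp: P_def pairwise_def)
      fix j k assume jk: "j < N" "k < N" "x j \<noteq> x k"
      then have "3 / 4 * h < \<bar>x j - x k\<bar>" by (intro sep') auto
      moreover have "\<bar>x j - x k\<bar> \<le> h / 2" if "dist (x j) z \<le> h / 4" "dist (x k) z \<le> h / 4" for z
        using that unfolding dist_real_def by linarith
      ultimately show "disjnt (cball (x j) (h / 4)) (cball (x k) (h / 4))"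
        using h by (force simp: disjnt_iff)
    qed
  qed (use x(1) h \<open>h \<le> \<delta>\<close> in \<open>auto simp: P_def\<close>)
  have "1 \<le> real N * (h / 2) powr s"
  proof -
    have "(h / 2) powr s = (l / 2) powr s / real N powr s"
      using l by (simp add: h_def powr_divide divide_simps powr_mult) 
    then have "real N * (h / 2) powr s = real N powr (1 - s) * (l / 2) powr s"
      using N(3) by (simp add: powr_diff)
    then show ?thesis using N by simp
  qed
  then have "1 \<le> ennreal (real N * (h / 2) powr s)" by simp
  also have "\<dots> = (\<Sum>(x, r)\<in>P. ennreal ((2 * r) powr s))"
    unfolding P_def by (subst sum.reindex[OF inj]) (simp add: ennreal_of_nat_eq_real_of_nat ennreal_mult')
  also have "\<dots> = (\<Sum>\<^sub>\<infinity>(x, r)\<in>P. ennreal ((2 * r) powr s))" by (simp add: P_def)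
  also have "\<dots> \<le> (SUP P\<in>packings \<delta> B. \<Sum>\<^sub>\<infinity>(x, r)\<in>P. ennreal ((2 * r) powr s))"
    using \<open>P \<in> packings \<delta> B\<close> by (rule SUP_upper)
  finally show "1 \<le> (SUP P\<in>packings \<delta> B. \<Sum>\<^sub>\<infinity>(x, r)\<in>P. ennreal ((2 * r) powr s))" .
qed

text \<open>
  If all members \<open>B i\<close> of a countable cover were nowhere dense, the complements of their closures
  together with \<open>A\<close> would be dense \<open>G\<^sub>\<delta>\<close> sets without a common point.
\<close>
lemma dense_gdelta_packing_measure_ge_1:
  assumes A: "dense_gdelta A" and s: "0 \<le> s" "s < 1"
  shows "1 \<le> packing_measure s A"
  unfolding packing_measure_def
proof (rule INF_greatest, clarify)
  fix B :: "nat \<Rightarrow> real set" assume B: "A \<subseteq> (\<Union>i. B i)"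
  have "\<exists>i. interior (closure (B i)) \<noteq> {}"
  proof (rule ccontr)
    assume "\<not> ?thesis"
    then have "dense_gdelta (- closure (B i))" for i
      by (intro dense_gdelta_open) (auto simp: closure_complement)
    then have "dense_gdelta (\<Inter>(insert A (range (\<lambda>i. - closure (B i)))))"
      using A by (intro dense_gdelta_Inter) auto
    then obtain x where "x \<in> \<Inter>(insert A (range (\<lambda>i. - closure (B i))))"
      using dense_gdelta_nonempty by blast
    then have "x \<in> A" "\<And>i. x \<notin> closure (B i)" by auto
    moreover obtain i where "x \<in> B i" using B \<open>x \<in> A\<close> by blast
    ultimately show False using closure_subset by blast
  qed
  then obtain i x where "x \<in> interior (closure (B i))" by blast
  then obtain e where "e > 0" "ball x e \<subseteq> closure (B i)" by (auto simp: mem_interior)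
  then have "1 \<le> packing_premeasure s (B i)"
    using s by (intro packing_premeasure_somewhere_dense[of s "x - e" "x + e"]) (auto simp: ball_eq_greaterThanLessThan)
  also have "\<dots> = (\<Sum>j\<in>{i}. packing_premeasure s (B j))" by simp
  also have "\<dots> \<le> (\<Sum>j. packing_premeasure s (B j))" by (intro sum_le_suminf) auto
  finally show "1 \<le> (\<Sum>j. packing_premeasure s (B j))" .
qed

lemma dense_gdelta_packing_dim:
  assumes A: "dense_gdelta A" shows "packing_dim A = 1"
  unfolding packing_dim_def
proof (rule antisym)
  show "1 \<le> Inf (ereal ` {s. 0 \<le> s \<and> packing_measure s A = 0})"
  proof (rule Inf_greatest, clarify)
    fix s :: real assume "0 \<le> s" "packing_measure s A = 0"
    then show "1 \<le> ereal s" using dense_gdelta_packing_measure_ge_1[OF A, of s] by (cases "s < 1") auto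
  qed
  show "Inf (ereal ` {s. 0 \<le> s \<and> packing_measure s A = 0}) \<le> 1"
  proof (rule ereal_le_epsilon2)
    fix e :: real assume "e > 0"
    then have "Inf (ereal ` {s. 0 \<le> s \<and> packing_measure s A = 0}) \<le> ereal (1 + e)"
      by (intro Inf_lower) (auto simp: packing_measure_eq_0)
    then show "Inf (ereal ` {s. 0 \<le> s \<and> packing_measure s A = 0}) \<le> 1 + ereal e"
      by (simp add: one_ereal_def)
  qed
qed

section \<open>A lower bound for the Hausdorff dimension\<close>

text \<open>
  The weight \<open>g i\<close> stands for the \<open>s\<close>-th power of the diameter of \<open>U i\<close>, slightly enlarged so that it
  is positive also for sets with at most one point; thus \<open>g i powr (1 / s)\<close> bounds the diameter.
\<close>
definition hit_weight :: "(nat \<Rightarrow> real) \<Rightarrow> (nat \<Rightarrow> real set) \<Rightarrow> real set \<Rightarrow> real" where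
  "hit_weight g U J = (\<Sum>i. if U i \<inter> J \<noteq> {} then g i else 0)"

lemma hit_weight_ge:
  assumes "summable g" "\<And>i. 0 < g i" "U i \<inter> J \<noteq> {}"
  shows "g i \<le> hit_weight g U J"
proof -
  have "summable (\<lambda>i. if U i \<inter> J \<noteq> {} then g i else 0)"
    by (rule summable_comparison_test_ev[OF _ assms(1)]) (use assms(2) in \<open>auto simp: less_imp_le\<close>)
  then have "(\<Sum>j\<in>{i}. if U j \<inter> J \<noteq> {} then g j else 0) \<le> hit_weight g U J"
    unfolding hit_weight_def by (rule sum_le_suminf) (use assms(2) in \<open>auto simp: less_imp_le\<close>)
  then show ?thesis using assms(3) by simp
qed

lemma card_progression_in_interval:
  fixes h b c :: real
  assumes "h > 0" "4 * h \<le> c"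
  shows "finite {m::int. b \<le> of_int m * h \<and> of_int m * h \<le> b + c}"
    and "c / (2 * h) \<le> real (card {m::int. b \<le> of_int m * h \<and> of_int m * h \<le> b + c})"
proof -
  have eq: "{m::int. b \<le> of_int m * h \<and> of_int m * h \<le> b + c} = {\<lceil>b / h\<rceil>..\<lfloor>(b + c) / h\<rfloor>}"
    using assms by (auto simp: ceiling_le_iff le_floor_iff field_simps)
  show "finite {m::int. b \<le> of_int m * h \<and> of_int m * h \<le> b + c}" unfolding eq by simp
  have "4 \<le> c / h" using assms by (simp add: field_simps)
  moreover have "(b + c) / h = b / h + c / h" by (simp add: add_divide_distrib)
  moreover have "c / (2 * h) = (c / h) / 2" by simp
  ultimately have "c / (2 * h) \<le> of_int (\<lfloor>(b + c) / h\<rfloor> - \<lceil>b / h\<rceil> + 1)" by linarith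
  also have "\<dots> \<le> real (nat (\<lfloor>(b + c) / h\<rfloor> - \<lceil>b / h\<rceil> + 1))" by linarith
  finally show "c / (2 * h) \<le> real (card {m::int. b \<le> of_int m * h \<and> of_int m * h \<le> b + c})"
    unfolding eq by simp
qed

lemma card_int_set_le:
  fixes H :: "int set" and D :: real
  assumes "finite H" "H \<noteq> {}" and "\<And>m m'. m \<in> H \<Longrightarrow> m' \<in> H \<Longrightarrow> of_int (m - m') \<le> D"
  shows "real (card H) \<le> D + 1"
proof -
  have "H \<subseteq> {Min H..Min H + \<lfloor>D\<rfloor>}"
  proof
    fix m assume m: "m \<in> H"
    then have "of_int (m - Min H) \<le> D" using assms by (intro assms(3)) auto
    then have "m - Min H \<le> \<lfloor>D\<rfloor>" by (simp only: le_floor_iff)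
    then show "m \<in> {Min H..Min H + \<lfloor>D\<rfloor>}" using assms(1) m by auto
  qed
  then have "card H \<le> card {Min H..Min H + \<lfloor>D\<rfloor>}" by (intro card_mono) auto
  also have "\<dots> = nat (\<lfloor>D\<rfloor> + 1)" by simp
  finally have "int (card H) \<le> max 0 (\<lfloor>D\<rfloor> + 1)" by linarith
  moreover have "0 \<le> D" using assms(2,3) by fastforce
  ultimately show ?thesis by linarith
qed

text \<open>
  Here \<open>I = {a..a + L}\<close> is the current interval and the candidates \<open>J m\<close> are intervals of length \<open>L'\<close>
  starting at the points of a progression with difference \<open>h\<close>.  Suppose that every \<open>J m\<close> inside \<open>I\<close>
  is hit with weight more than \<open>c = L' powr s / 8\<close>.  Truncate the relative weights to
  \<open>w i = min 1 (g i / c)\<close>; each \<open>J m\<close> still collects a total of at least 1, so the double sum over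
  \<open>m\<close> and \<open>i\<close> is at least the number of candidates, which is at least \<open>L / (4 * h)\<close>.  But a set of
  diameter \<open>d\<close> hits at most \<open>d / h + 2\<close> candidates.  Using \<open>w i \<le> 1\<close> for the first summand and
  \<open>w i \<le> g i / c\<close> for the second, its contribution is at most \<open>d / h + 2 * g i / c\<close>.
  Since \<open>d \<le> g i * L powr (1 - s)\<close>, the double sum is at most \<open>L / (8 * h)\<close> plus a term that the last
  hypothesis makes smaller than \<open>L / (8 * h)\<close>.  The truncation is what allows large and small sets
  of the cover to be treated together.
\<close>
lemma exists_light_subinterval:
  fixes g :: "nat \<Rightarrow> real" and U :: "nat \<Rightarrow> real set" and a L h \<theta> L' s :: real
  assumes s: "0 < s" "s < 1" and g: "summable g" "\<And>i. 0 < g i"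
    and U: "\<And>i x y. x \<in> U i \<Longrightarrow> y \<in> U i \<Longrightarrow> \<bar>x - y\<bar> \<le> g i powr (1 / s)"
    and light: "hit_weight g U {a..a + L} \<le> L powr s / 8"
    and L': "0 < L'" "L' \<le> h" and h: "8 * h \<le> L"
    and fine: "16 * h * L powr s < L * L' powr s"
  shows "\<exists>m::int. a \<le> of_int m * h + \<theta> \<and> of_int m * h + \<theta> + L' \<le> a + L \<and>
           hit_weight g U {of_int m * h + \<theta>..of_int m * h + \<theta> + L'} \<le> L' powr s / 8"
proof (rule ccontr)
  assume contr: "\<not> ?thesis"
  define J where "J m = {of_int m * h + \<theta>..of_int m * h + \<theta> + L'}" for m :: int
  define M where "M = {m::int. a - \<theta> \<le> of_int m * h \<and> of_int m * h \<le> a - \<theta> + L / 2}"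
  define c where "c = L' powr s / 8"
  define w where "w i = min 1 (g i / c)" for i
  have h0: "h > 0" "L > 0" and c0: "c > 0" using L' h by (auto simp: c_def)
  have M: "finite M" "L / (4 * h) \<le> real (card M)"
    using card_progression_in_interval[of h "L / 2" "a - \<theta>"] h0 h by (auto simp: M_def)
  have heavy: "c < hit_weight g U (J m)" and sub: "J m \<subseteq> {a..a + L}" if "m \<in> M" for m
  proof -
    have "a \<le> of_int m * h + \<theta>" "of_int m * h + \<theta> + L' \<le> a + L"
      using that L' h h0 by (auto simp: M_def)
    then show "c < hit_weight g U (J m)" "J m \<subseteq> {a..a + L}"
      using contr unfolding J_def c_def by (metis not_le, auto)
  qed
  have w0: "0 < w i" "w i \<le> g i / c" "w i \<le> 1" for i using g(2)[of i] c0 by (auto simp: w_def)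
  have sgc: "summable (\<lambda>i. g i / c)" using g(1) by (rule summable_divide)
  have sw: "summable (\<lambda>i. if P i then w i else 0)" for P
    by (rule summable_comparison_test_ev[OF _ sgc]) (use w0 g(2) c0 in \<open>auto simp: less_imp_le\<close>)
  have ge1: "1 \<le> (\<Sum>i. if U i \<inter> J m \<noteq> {} then w i else 0)" if m: "m \<in> M" for m
  proof (cases "\<exists>i. U i \<inter> J m \<noteq> {} \<and> g i / c \<ge> 1")
    case True
    then obtain i where i: "U i \<inter> J m \<noteq> {}" "g i / c \<ge> 1" by blast
    have "(\<Sum>j\<in>{i}. if U j \<inter> J m \<noteq> {} then w j else 0) \<le> (\<Sum>i. if U i \<inter> J m \<noteq> {} then w i else 0)"
      by (rule sum_le_suminf[OF sw]) (use w0 in \<open>auto simp: less_imp_le\<close>)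
    then show ?thesis using i by (simp add: w_def min_def)
  next
    case False
    then have "(if U i \<inter> J m \<noteq> {} then w i else 0) = (if U i \<inter> J m \<noteq> {} then g i else 0) / c" for i
      by (cases "U i \<inter> J m = {}") (auto simp: w_def min_def)
    moreover have "summable (\<lambda>i. if U i \<inter> J m \<noteq> {} then g i else 0)"
      by (rule summable_comparison_test_ev[OF _ g(1)]) (use g(2) in \<open>auto simp: less_imp_le\<close>)
    ultimately have "(\<Sum>i. if U i \<inter> J m \<noteq> {} then w i else 0) = hit_weight g U (J m) / c"
      by (simp add: hit_weight_def suminf_divide)
    then show ?thesis using heavy[OF m] c0 by simp
  qed
  define B where "B = 2 / c + L powr (1 - s) / h"
  have B0: "B > 0" using c0 h0 by (auto simp: B_def intro!: add_pos_pos)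
  have bound: "(\<Sum>m\<in>M. if U i \<inter> J m \<noteq> {} then w i else 0) \<le> (if U i \<inter> {a..a + L} \<noteq> {} then g i else 0) * B" for i
  proof -
    define H where "H = {m \<in> M. U i \<inter> J m \<noteq> {}}"
    define d where "d = g i powr (1 / s)"
    have eq: "(\<Sum>m\<in>M. if U i \<inter> J m \<noteq> {} then w i else 0) = real (card H) * w i"
      using M(1) by (simp add: sum.If_cases H_def Int_def)
    show ?thesis
    proof (cases "H = {}")
      case True
      then show ?thesis unfolding eq using B0 g(2)[of i] by simp
    next
      case False
      then obtain m where "m \<in> M" "U i \<inter> J m \<noteq> {}" by (auto simp: H_def)
      then have hit: "U i \<inter> {a..a + L} \<noteq> {}" using sub[of m] by blast
      have gi: "0 < g i" by (rule g)
      have "g i \<le> L powr s"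
        using hit_weight_ge[of g U i "{a..a + L}", OF g hit] light powr_ge_zero[of L s] by linarith
      then have "d \<le> (L powr s) powr (1 / s)" unfolding d_def using gi s by (intro powr_mono2) auto
      then have dL: "d \<le> L" using s h0 by (simp add: powr_powr)
      have d0: "d > 0" using gi by (simp add: d_def)
      have "d = d powr s * d powr (1 - s)" using d0 by (simp flip: powr_add)
      also have "d powr s = g i" using s gi by (simp add: d_def powr_powr)
      also have "g i * d powr (1 - s) \<le> g i * L powr (1 - s)"
        using dL d0 s gi by (intro mult_left_mono powr_mono2) auto
      finally have d: "d \<le> g i * L powr (1 - s)" .
      have "real (card H) \<le> (d / h + 1) + 1"
      proof (rule card_int_set_le[OF _ False])
        show "finite H" using M(1) by (simp add: H_def)
        fix m m' assume "m \<in> H" "m' \<in> H"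
        then obtain x y where x: "x \<in> U i" "x \<in> J m" and y: "y \<in> U i" "y \<in> J m'" by (auto simp: H_def)
        have "\<bar>x - y\<bar> \<le> d" unfolding d_def using x y by (intro U) auto
        then have "of_int m * h - of_int m' * h \<le> d + h" using x y L' unfolding J_def atLeastAtMost_iff by linarith
        then show "of_int (m - m') \<le> d / h + 1" using h0 by (simp add: field_simps)
      qed
      then have "real (card H) * w i \<le> (d / h + 2) * w i"
        using w0[of i] by (intro mult_right_mono) auto
      also have "\<dots> = d / h * w i + 2 * w i" by (simp add: algebra_simps)
      also have "\<dots> \<le> d / h * 1 + 2 * (g i / c)"
        using w0[of i] d0 h0 by (intro add_mono mult_left_mono) auto
      also have "\<dots> \<le> g i * L powr (1 - s) / h * 1 + 2 * (g i / c)"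
        using d h0 gi c0 by (intro add_mono mult_right_mono divide_right_mono) auto
      also have "\<dots> = g i * B" by (simp add: B_def algebra_simps)
      finally show ?thesis unfolding eq using hit by simp
    qed
  qed
  have sI: "summable (\<lambda>i. if U i \<inter> {a..a + L} \<noteq> {} then g i else 0)"
    by (rule summable_comparison_test_ev[OF _ g(1)]) (use g(2) in \<open>auto simp: less_imp_le\<close>)
  have "L / (4 * h) \<le> (\<Sum>m\<in>M. 1)" using M by simp
  also have "\<dots> \<le> (\<Sum>m\<in>M. \<Sum>i. if U i \<inter> J m \<noteq> {} then w i else 0)"
    by (intro sum_mono ge1)
  also have "\<dots> = (\<Sum>i. \<Sum>m\<in>M. if U i \<inter> J m \<noteq> {} then w i else 0)"
    by (rule suminf_sum[symmetric]) (rule sw)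
  also have "\<dots> \<le> (\<Sum>i. (if U i \<inter> {a..a + L} \<noteq> {} then g i else 0) * B)"
    by (intro suminf_le bound summable_sum sw summable_mult2 sI)
  also have "\<dots> = hit_weight g U {a..a + L} * B"
    unfolding hit_weight_def by (rule suminf_mult2[symmetric, OF sI])
  also have "\<dots> \<le> L powr s / 8 * B" using light B0 by (intro mult_right_mono) auto
  also have "\<dots> = 2 * L powr s / L' powr s + L powr s * L powr (1 - s) / (8 * h)"
    using L' h0 by (simp add: B_def c_def field_simps)
  also have "L powr s * L powr (1 - s) = L" using h0 by (simp flip: powr_add)
  also have "2 * L powr s / L' powr s < L / (8 * h)"
    using fine L' h0 by (simp add: field_simps)
  finally have "L / (4 * h) < L / (8 * h) + L / (8 * h)" by simp
  then show False using h0 by (simp add: field_simps)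
qed

text \<open>
  The approximation error is \<open>o(1)\<close> times the square of \<open>1 / p ^ n\<close>; the index \<open>k\<close> drives both the
  size of \<open>n\<close> and the \<open>o(1)\<close>.  Requiring \<open>P\<close> to be prime to \<open>p\<close> prevents a fraction with bounded
  denominator from being used infinitely often.
\<close>
definition p_adically_approximable :: "nat \<Rightarrow> real set" where
  "p_adically_approximable p =
     {\<xi>. \<forall>k. \<exists>n>k. \<exists>P. coprime P (int p) \<and>
        \<bar>\<xi> - of_int P / real p ^ n\<bar> \<le> 1 / real (Suc k) / real p ^ (2 * n)}"

text \<open>
  The numerators \<open>P = m * p + 1\<close> are prime to \<open>p\<close>, and the fractions form a progression of difference
  \<open>h = p / p ^ n\<close>.  With \<open>L' = \<delta> / p ^ (2 * n)\<close> the quotient \<open>h / L' powr s\<close> is a constant times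
  \<open>p powr (n * (2 * s - 1))\<close>.  It tends to 0 exactly because \<open>s < 1 / 2\<close>.
\<close>
lemma exists_light_p_adic_subinterval:
  fixes g :: "nat \<Rightarrow> real" and U :: "nat \<Rightarrow> real set" and a L s \<delta> :: real
  assumes p: "prime p" and s: "0 < s" "s < 1 / 2" and g: "summable g" "\<And>i. 0 < g i"
    and U: "\<And>i x y. x \<in> U i \<Longrightarrow> y \<in> U i \<Longrightarrow> \<bar>x - y\<bar> \<le> g i powr (1 / s)"
    and light: "hit_weight g U {a..a + L} \<le> L powr s / 8" and L: "0 < L"
    and \<delta>: "0 < \<delta>" "\<delta> \<le> 1"
  shows "\<exists>n>k. \<exists>P. coprime P (int p) \<and> a \<le> of_int P / real p ^ n \<and>
           of_int P / real p ^ n + \<delta> / real p ^ (2 * n) \<le> a + L \<and>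
           hit_weight g U {of_int P / real p ^ n..of_int P / real p ^ n + \<delta> / real p ^ (2 * n)}
             \<le> (\<delta> / real p ^ (2 * n)) powr s / 8"
proof -
  have p2: "real p \<ge> 2" using prime_ge_2_nat[OF p] by simp
  define r where "r = real p powr (2 * s - 1)"
  have r: "0 < r" "r < 1"
    using p2 s powr_less_mono[of "2 * s - 1" 0 "real p"] by (auto simp: r_def)
  have ev1: "\<forall>\<^sub>F n in sequentially. r ^ n < L * \<delta> powr s / (16 * real p * L powr s)"
    by (rule order_tendstoD(2)[OF LIMSEQ_realpow_zero]) (use r L p2 \<delta> in auto)
  have ev2: "\<forall>\<^sub>F n in sequentially. (1 / real p) ^ n < L / (8 * real p)"
    by (rule order_tendstoD(2)[OF LIMSEQ_realpow_zero]) (use L p2 in auto)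
  have ev: "\<forall>\<^sub>F n in sequentially. n > k \<and> r ^ n < L * \<delta> powr s / (16 * real p * L powr s)
      \<and> (1 / real p) ^ n < L / (8 * real p)"
    using ev1 ev2 eventually_gt_at_top[of k] by eventually_elim simp
  obtain n where n: "n > k" "r ^ n < L * \<delta> powr s / (16 * real p * L powr s)"
      "(1 / real p) ^ n < L / (8 * real p)"
    using eventually_happens'[OF sequentially_bot ev] by blast
  define b where "b = real p ^ n"
  have b: "b \<ge> 1" unfolding b_def using p2 by (intro one_le_power) auto
  define h where "h = real p / b"
  define L' where "L' = \<delta> / real p ^ (2 * n)"
  have pb: "real p ^ (2 * n) = b * b" by (simp add: b_def mult_2 power_add)
  have pbs: "(b * b) powr s = r ^ n * b"
  proof -
    have "b = real p powr real n" using p2 by (simp add: b_def powr_realpow)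
    then have "(b * b) powr s = real p powr (2 * s * real n)"
      by (simp add: powr_powr flip: powr_add) (simp add: algebra_simps)
    also have "\<dots> = real p powr ((2 * s - 1) * real n) * real p powr real n"
      by (simp add: algebra_simps flip: powr_add)
    also have "real p powr ((2 * s - 1) * real n) = r ^ n"
      using r by (simp add: r_def powr_powr[symmetric] powr_realpow)
    also have "real p powr real n = b" using p2 by (simp add: b_def powr_realpow)
    finally show ?thesis .
  qed
  have "\<exists>m::int. a \<le> of_int m * h + 1 / b \<and> of_int m * h + 1 / b + L' \<le> a + L \<and>
           hit_weight g U {of_int m * h + 1 / b..of_int m * h + 1 / b + L'} \<le> L' powr s / 8"
  proof (rule exists_light_subinterval[OF _ _ g U light])
    show "0 < L'" using \<delta> p2 by (simp add: L'_def)
    have "\<delta> / b / b \<le> real p / b / 1"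
      using \<delta> p2 b by (intro frac_le divide_right_mono) auto
    then show "L' \<le> h" by (simp add: L'_def pb h_def)
    show "8 * h \<le> L" using n(3) p2 b by (simp add: h_def b_def power_one_over field_simps)
    have L'pow: "L' powr s = \<delta> powr s / (r ^ n * b)"
      using \<delta> b by (simp only: L'_def pb powr_divide pbs)
    have "16 * real p * L powr s * r ^ n < L * \<delta> powr s"
      using n(2) p2 L by (simp add: field_simps)
    then have "16 * real p * L powr s * r ^ n / (r ^ n * b) < L * \<delta> powr s / (r ^ n * b)"
      using r b by (intro divide_strict_right_mono) auto
    then show "16 * h * L powr s < L * L' powr s"
      using r b unfolding L'pow h_def by (simp add: field_simps)
  qed (use s in auto)
  then obtain m :: int where m: "a \<le> of_int m * h + 1 / b" "of_int m * h + 1 / b + L' \<le> a + L"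
      "hit_weight g U {of_int m * h + 1 / b..of_int m * h + 1 / b + L'} \<le> L' powr s / 8"
    by blast
  have "of_int m * h + 1 / b = of_int (m * int p + 1) / real p ^ n"
    by (simp add: h_def b_def add_divide_distrib)
  moreover have "coprime (m * int p + 1) (int p)"
    by (rule coprimeI) (metis dvd_add_right_iff dvd_mult)
  ultimately show ?thesis using m n(1) by (intro exI[of _ n] conjI exI[of _ "m * int p + 1"]) (auto simp: L'_def)
qed

text \<open>
  Iterating the previous lemma gives a decreasing sequence of intervals.  A set \<open>U i\<close> containing
  their common point would have weight at most \<open>L powr s / 8\<close> for all lengths \<open>L\<close> of the sequence,
  contradicting \<open>g i > 0\<close>.
\<close>
lemma exists_uncovered_p_adically_approximable:
  fixes g :: "nat \<Rightarrow> real" and U :: "nat \<Rightarrow> real set"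
  assumes p: "prime p" and s: "0 < s" "s < 1 / 2" and g: "summable g" "\<And>i. 0 < g i" "suminf g \<le> 1 / 8"
    and U: "\<And>i x y. x \<in> U i \<Longrightarrow> y \<in> U i \<Longrightarrow> \<bar>x - y\<bar> \<le> g i powr (1 / s)"
  shows "\<exists>\<xi> \<in> p_adically_approximable p. \<forall>i. \<xi> \<notin> U i"
proof -
  let ?I = "\<lambda>(a, L). {a..a + L :: real}"
  define good where "good z \<longleftrightarrow> 0 < snd z \<and> hit_weight g U (?I z) \<le> snd z powr s / 8" for z :: "real \<times> real"
  define child where "child k z z' \<longleftrightarrow> ?I z' \<subseteq> ?I z \<and> (\<exists>n>k. \<exists>P. coprime P (int p) \<and>
     fst z' = of_int P / real p ^ n \<and> snd z' = 1 / real (Suc k) / real p ^ (2 * n))" for k z z'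
  have "\<exists>f. \<forall>k. good (f k) \<and> child k (f k) (f (Suc k))"
  proof (rule dependent_nat_choice)
    have "hit_weight g U {0..1} \<le> suminf g"
      unfolding hit_weight_def
      by (intro suminf_le g(1) summable_comparison_test_ev[OF _ g(1)]) (use g(2) in \<open>auto simp: less_imp_le\<close>)
    then have "good (0, 1)" using g(3) by (simp add: good_def)
    then show "\<exists>z. good z" by blast
  next
    fix z k assume z: "good z"
    obtain a L where aL: "z = (a, L)" by (cases z)
    have "\<exists>n>k. \<exists>P. coprime P (int p) \<and> a \<le> of_int P / real p ^ n \<and>
           of_int P / real p ^ n + 1 / real (Suc k) / real p ^ (2 * n) \<le> a + L \<and>
           hit_weight g U {of_int P / real p ^ n..of_int P / real p ^ n + 1 / real (Suc k) / real p ^ (2 * n)}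
             \<le> (1 / real (Suc k) / real p ^ (2 * n)) powr s / 8"
      using z by (intro exists_light_p_adic_subinterval[OF p s g(1,2) U]) (auto simp: good_def aL)
    then obtain n P where nP: "n > k" "coprime P (int p)" "a \<le> of_int P / real p ^ n"
           "of_int P / real p ^ n + 1 / real (Suc k) / real p ^ (2 * n) \<le> a + L"
           "hit_weight g U {of_int P / real p ^ n..of_int P / real p ^ n + 1 / real (Suc k) / real p ^ (2 * n)}
             \<le> (1 / real (Suc k) / real p ^ (2 * n)) powr s / 8"
      by blast
    define z' where "z' = (of_int P / real p ^ n, 1 / real (Suc k) / real p ^ (2 * n))"
    have "0 < real p" using prime_gt_0_nat[OF p] by simp
    then have "good z'" using nP(5) by (simp add: good_def z'_def)
    moreover have "?I z' \<subseteq> ?I z" using nP(3,4) by (auto simp: z'_def aL)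
    then have "child k z z'" unfolding child_def using nP(1,2) by (auto simp: z'_def)
    ultimately show "\<exists>z'. good z' \<and> child k z z'" by blast
  qed
  then obtain f where f: "\<And>k. good (f k)" "\<And>k. child k (f k) (f (Suc k))" by blast
  define K where "K k = ?I (f k)" for k
  have Keq: "K k = {fst (f k)..fst (f k) + snd (f k)}" for k by (simp add: K_def case_prod_beta)
  have "K (Suc k) \<subseteq> K k" for k using f(2)[of k] by (simp add: child_def K_def)
  then have mono: "K n \<subseteq> K m" if "m \<le> n" for m n
    using lift_Suc_antimono_le[of K] that by blast
  obtain \<xi> where \<xi>: "\<And>k. \<xi> \<in> K k"
  proof (rule bounded_closed_nest[of K])
    show "K k \<noteq> {}" for k using f(1)[of k] by (simp add: Keq good_def)
  qed (use mono in \<open>auto simp: Keq\<close>)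
  have "\<xi> \<in> p_adically_approximable p"
    unfolding p_adically_approximable_def
  proof (intro CollectI allI)
    fix k
    obtain n P where "n > k" "coprime P (int p)" "fst (f (Suc k)) = of_int P / real p ^ n"
       "snd (f (Suc k)) = 1 / real (Suc k) / real p ^ (2 * n)"
      using f(2)[of k] unfolding child_def by blast
    moreover from \<xi>[of "Suc k"] have "\<bar>\<xi> - fst (f (Suc k))\<bar> \<le> snd (f (Suc k))"
      by (auto simp: Keq)
    ultimately show "\<exists>n>k. \<exists>P. coprime P (int p) \<and> \<bar>\<xi> - of_int P / real p ^ n\<bar> \<le> 1 / real (Suc k) / real p ^ (2 * n)"
      by metis
  qed
  moreover have "\<xi> \<notin> U i" for i
  proof
    assume i: "\<xi> \<in> U i"
    define c where "c = g i powr (1 / s)"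
    have c: "c > 0" using g(2)[of i] by (simp add: c_def)
    then obtain k where k: "1 / c < real k" using reals_Archimedean2 by blast
    define L where "L = snd (f (Suc k))"
    have "g i \<le> hit_weight g U (K (Suc k))" using i \<xi> by (intro hit_weight_ge g) auto
    also have "\<dots> \<le> L powr s / 8" using f(1)[of "Suc k"] by (simp add: good_def K_def L_def)
    also have "\<dots> \<le> L powr s" by simp
    finally have "c \<le> (L powr s) powr (1 / s)" unfolding c_def using g(2) s by (intro powr_mono2) (simp_all add: less_imp_le)
    also have "\<dots> = L" using s f(1)[of "Suc k"] by (simp add: powr_powr L_def good_def)
    also have "L \<le> 1 / real (Suc k)"
    proof -
      obtain n where n: "L = 1 / real (Suc k) / real p ^ (2 * n)"
        using f(2)[of k] unfolding child_def L_def by blast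
      have "1 \<le> real p ^ (2 * n)" using prime_ge_1_nat[OF p] by (intro one_le_power) simp
      then have "1 / real (Suc k) / real p ^ (2 * n) \<le> 1 / real (Suc k) / 1"
        using prime_gt_0_nat[OF p] by (intro divide_left_mono) auto
      then show ?thesis using n by simp
    qed
    finally have "real (Suc k) \<le> 1 / c" using c by (simp add: field_simps)
    then show False using k by simp
  qed
  ultimately show ?thesis by blast
qed

text \<open>
  A cover of \<open>A\<close> by sets of arbitrarily small total weight would also cover the approximable points.
  The exponent 0 is separate: there every nonempty set of the cover contributes 1.
\<close>
lemma hausdorff_dim_ge_half:
  assumes p: "prime p" and A: "p_adically_approximable p \<subseteq> A" "A \<noteq> {}"
  shows "1 / 2 \<le> hausdorff_dim A"
  unfolding hausdorff_dim_def
proof (rule Inf_greatest, clarify)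
  fix s assume s: "0 \<le> s" "hausdorff_measure s A = 0"
  show "1 / 2 \<le> ereal s"
  proof (rule ccontr)
    assume "\<not> 1 / 2 \<le> ereal s"
    then have s2: "s < 1 / 2" by (simp add: not_le one_ereal_def divide_ereal_def)
    have "hausdorff_premeasure s 1 A \<le> hausdorff_measure s A"
      unfolding hausdorff_measure_def by (rule SUP_upper) simp
    then have "hausdorff_premeasure s 1 A < ennreal (1 / 16)" using s by (simp add: order.strict_trans1)
    then obtain U where U: "A \<subseteq> (\<Union>i. U i)" "\<And>i. bounded (U i)" "(\<Sum>i. diam_pow s (U i)) < ennreal (1 / 16)"
      unfolding hausdorff_premeasure_def INF_less_iff by auto
    show False
    proof (cases "s = 0")
      case True
      obtain i where "U i \<noteq> {}" using U(1) A(2) by blast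
      then have "1 = (\<Sum>j\<in>{i}. diam_pow s (U j))" by (simp add: diam_pow_def True)
      also have "\<dots> \<le> (\<Sum>i. diam_pow s (U i))" by (intro sum_le_suminf) auto
      also have "\<dots> < ennreal (1 / 16)" by (rule U(3))
      also have "\<dots> \<le> 1" by (simp add: ennreal_le_1)
      finally show False by simp
    next
      case False
      then have s0: "s > 0" using s by simp
      define D where "D i = (if U i = {} then 0 else diameter (U i) powr s)" for i
      have D: "diam_pow s (U i) = ennreal (D i)" "0 \<le> D i" for i
        using s0 by (auto simp: D_def diam_pow_def)
      have fin: "(\<Sum>i. ennreal (D i)) < ennreal (1 / 16)" using U(3) by (simp add: D)
      then have "(\<Sum>i. ennreal (D i)) \<noteq> top" by auto
      then have sumD: "summable D" by (intro summable_suminf_not_top D)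
      then have "ennreal (suminf D) < ennreal (1 / 16)" using fin D(2) by (simp add: suminf_ennreal2)
      then have D16: "suminf D \<le> 1 / 16" using suminf_nonneg[OF sumD D(2)] by (simp add: ennreal_less_iff)
      \<comment> \<open>The geometric summand makes the weights positive and adds only \<open>1 / 16\<close> in total.\<close>
      define g where "g i = D i + (1 / 2) ^ i * (1 / 32)" for i
      have geo: "(\<lambda>i. (1 / 2) ^ i * (1 / 32 :: real)) sums (2 * (1 / 32))"
        using sums_mult2[OF geometric_sums[of "1 / 2 :: real"], of "1 / 32"] by simp
      have gsums: "g sums (suminf D + 2 * (1 / 32))"
        unfolding g_def by (intro sums_add geo summable_sums sumD)
      have "\<exists>\<xi> \<in> p_adically_approximable p. \<forall>i. \<xi> \<notin> U i"
      proof (rule exists_uncovered_p_adically_approximable[OF p s0 s2])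
        show "summable g" using gsums by (rule sums_summable)
        show "0 < g i" for i using D(2)[of i] by (simp add: g_def add_nonneg_pos)
        show "suminf g \<le> 1 / 8" using sums_unique[OF gsums] D16 by simp
        show "\<bar>x - y\<bar> \<le> g i powr (1 / s)" if xy: "x \<in> U i" "y \<in> U i" for i x y
        proof -
          have "\<bar>x - y\<bar> \<le> diameter (U i)"
            using diameter_bounded_bound[OF U(2) xy] by (simp add: dist_real_def)
          moreover have "0 \<le> diameter (U i)" using U(2) by (rule diameter_ge_0)
          ultimately have "\<bar>x - y\<bar> \<le> (D i) powr (1 / s)"
            using s0 xy by (auto simp: D_def powr_powr)
          also have "\<dots> \<le> g i powr (1 / s)" using s0 D(2) by (intro powr_mono2) (auto simp: g_def)
          finally show ?thesis .
        qed
      qed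
      then show False using A(1) U(1) by blast
    qed
  qed
qed

section \<open>The sets \<open>Gamma_set\<close> and \<open>Gamma_tilde\<close>\<close>

lemma open_mult_min_S_dist_greater:
  assumes "Q \<ge> 1" "c > 0"
  shows "open {\<xi>. r < c * min_S_dist S \<xi> Q}"
proof -
  have "{\<xi>. r < c * min_S_dist S \<xi> Q} = {\<xi>. r / c < min_S_dist S \<xi> Q}"
    using assms(2) by (auto simp: field_simps)
  then show ?thesis using open_min_S_dist_greater[OF assms(1)] by simp
qed

lemma Gamma_set_eq_limsup_ge:
  assumes "S \<subseteq> {p. prime p}"
  shows "Gamma_set S = {\<xi>. 1 \<le> limsup (\<lambda>Q. ereal (real Q * min_S_dist S \<xi> Q))}"
proof -
  have "limsup (\<lambda>Q. ereal (real Q * min_S_dist S \<xi> Q)) \<le> 1" for \<xi>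
  proof (rule Limsup_bounded)
    show "\<forall>\<^sub>F Q in sequentially. ereal (real Q * min_S_dist S \<xi> Q) \<le> 1"
      using eventually_ge_at_top[of 1] by eventually_elim (simp add: min_S_dist_Dirichlet[OF assms])
  qed
  then show ?thesis by (auto simp: Gamma_set_def intro: antisym)
qed

text \<open>
  The fractions \<open>P / p ^ n\<close> with \<open>P = m * p + 1\<close> and \<open>n\<close> large come within \<open>p / p ^ n\<close> of every real
  number.
\<close>
lemma dense_gdelta_Gamma_set:
  assumes p: "prime p"
  shows "dense_gdelta (Gamma_set {p})"
proof -
  have p2: "real p \<ge> 2" using prime_ge_2_nat[OF p] by simp
  have S: "{p} \<subseteq> {p. prime p}" using p by simp
  show ?thesis
    unfolding Gamma_set_eq_limsup_ge[OF S]
  proof (rule dense_gdelta_limsup_ge)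
    fix r N and V :: "real set"
    assume "ereal r < 1" and V: "open V" "V \<noteq> {}"
    then have r: "r < 1" by simp
    obtain x e where e: "e > 0" "\<And>y. \<bar>y - x\<bar> < e \<Longrightarrow> y \<in> V"
      using V unfolding open_dist dist_real_def by blast
    have "\<forall>\<^sub>F n in sequentially. (1 / real p) ^ n < min (e / real p) (1 - r)"
      by (rule order_tendstoD(2)[OF LIMSEQ_realpow_zero]) (use r p2 e in auto)
    then have ev: "\<forall>\<^sub>F n in sequentially. (1 / real p) ^ n < min (e / real p) (1 - r) \<and> N < n"
      using eventually_gt_at_top[of N] by eventually_elim simp
    obtain n where n: "(1 / real p) ^ n < min (e / real p) (1 - r)" "N < n"
      using eventually_happens'[OF sequentially_bot ev] by blast
    define b where "b = real p ^ n"
    have b: "b > 0" "1 / b < e / real p" "1 / b < 1 - r"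
      using n(1) p2 by (auto simp: b_def power_one_over)
    define m where "m = \<lfloor>x * b / real p\<rfloor>"
    define P where "P = m * int p + 1"
    have "of_int m \<le> x * b / real p" "x * b / real p < of_int m + 1" unfolding m_def by linarith+
    then have "of_int m * real p \<le> x * b" "x * b < of_int m * real p + real p"
      using p2 by (auto simp: field_simps)
    then have "\<bar>of_int P - x * b\<bar> \<le> real p" using p2 by (auto simp: P_def)
    also have "\<dots> < e * b" using b p2 by (simp add: field_simps)
    finally have "\<bar>(of_int P - x * b) / b\<bar> < e" using b by (simp add: abs_divide field_simps)
    also have "(of_int P - x * b) / b = of_int P / b - x"
      using b by (simp add: field_simps)
    finally have PV: "of_int P / b \<in> V" by (rule e)
    have "n < p ^ n" using prime_ge_2_nat[OF p] by (intro power_gt_expt) auto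
    then have "p ^ n - 1 \<ge> N" using n(2) by simp
    moreover have "coprime P (int p)"
      unfolding P_def by (rule coprimeI) (metis dvd_add_right_iff dvd_mult)
    then have "(1 - 1 / b) * (1 - 0) \<le> real (p ^ n - 1) * min_S_dist {p} (of_int P / b) (p ^ n - 1)"
      unfolding b_def using n(2) by (intro min_S_dist_near_p_adic[OF p]) auto
    then have "r < real (p ^ n - 1) * min_S_dist {p} (of_int P / b) (p ^ n - 1)" using b by simp
    ultimately show "\<exists>Q\<ge>N. \<exists>x\<in>V. r < real Q * min_S_dist {p} x Q" using PV by blast
  qed (auto intro: open_mult_min_S_dist_greater)
qed

lemma p_adically_approximable_subset_Gamma_set:
  assumes p: "prime p"
  shows "p_adically_approximable p \<subseteq> Gamma_set {p}"
proof
  fix \<xi> assume \<xi>: "\<xi> \<in> p_adically_approximable p"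
  have S: "{p} \<subseteq> {p. prime p}" using p by simp
  have "1 \<le> limsup (\<lambda>Q. ereal (real Q * min_S_dist {p} \<xi> Q))"
    unfolding le_limsup_iff_rat
  proof (intro allI impI)
    fix q N assume "ereal (of_rat q) < 1"
    then have q: "of_rat q < (1 :: real)" by simp
    obtain k0 :: nat where k0: "2 / (1 - of_rat q) < real k0" using reals_Archimedean2 by blast
    define k where "k = max k0 N"
    have k: "2 / (1 - of_rat q) < real (Suc k)" "k \<ge> N"
      using k0 by (auto simp: k_def less_Suc_eq_le)
    define \<delta> where "\<delta> = 1 / real (Suc k)"
    have \<delta>: "0 \<le> \<delta>" "\<delta> \<le> 1" "2 * \<delta> < 1 - of_rat q"
      using k(1) q by (auto simp: \<delta>_def field_simps)
    obtain n P where nP: "n > k" "coprime P (int p)" "\<bar>\<xi> - of_int P / real p ^ n\<bar> \<le> \<delta> / real p ^ (2 * n)"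
      using \<xi> unfolding p_adically_approximable_def \<delta>_def by blast
    have np: "n < p ^ n" using prime_ge_2_nat[OF p] by (intro power_gt_expt) auto
    then have "Suc k \<le> p ^ n" using nP(1) by simp
    then have "real (Suc k) \<le> real p ^ n" by (simp flip: of_nat_power)
    then have "1 / real p ^ n \<le> \<delta>" unfolding \<delta>_def by (intro divide_left_mono) (auto simp: prime_gt_0_nat[OF p])
    then have "(1 - \<delta>) * (1 - \<delta>) \<le> (1 - 1 / real p ^ n) * (1 - \<delta>)"
      using \<delta> by (intro mult_right_mono) auto
    also have "\<dots> \<le> real (p ^ n - 1) * min_S_dist {p} \<xi> (p ^ n - 1)"
      using nP \<delta> by (intro min_S_dist_near_p_adic[OF p]) auto
    finally have "(1 - \<delta>) * (1 - \<delta>) \<le> real (p ^ n - 1) * min_S_dist {p} \<xi> (p ^ n - 1)" .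
    then have "1 - 2 * \<delta> \<le> real (p ^ n - 1) * min_S_dist {p} \<xi> (p ^ n - 1)"
      using zero_le_square[of \<delta>] unfolding right_diff_distrib left_diff_distrib by linarith
    then have "of_rat q < real (p ^ n - 1) * min_S_dist {p} \<xi> (p ^ n - 1)" using \<delta> by linarith
    moreover have "p ^ n - 1 \<ge> N" using np nP(1) k(2) by simp
    ultimately show "\<exists>Q\<ge>N. of_rat q < real Q * min_S_dist {p} \<xi> Q" by blast
  qed
  then show "\<xi> \<in> Gamma_set {p}" unfolding Gamma_set_eq_limsup_ge[OF S] by simp
qed

text \<open>
  Fix a fraction \<open>a / d\<close> in the given open set and put \<open>\<eta> = 1 / (2 * d * Q)\<close>.  Near \<open>a / d\<close> the
  quantity \<open>Q * \<Phi> Q * min_S_dist\<close> then takes a value of at least \<open>\<Phi> Q / (2 * d)\<close>, and \<open>Q\<close> may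
  grow while \<open>d\<close> stays fixed.
\<close>
lemma dense_gdelta_Gamma_tilde:
  assumes S: "S \<subseteq> {p. prime p}" and \<Phi>: "\<And>n. n \<ge> 1 \<Longrightarrow> \<Phi> n > 0" "filterlim \<Phi> at_top at_top"
  shows "dense_gdelta (Gamma_tilde S \<Phi>)"
proof -
  have "dense_gdelta {\<xi>. \<infinity> \<le> limsup (\<lambda>Q. ereal (real Q * \<Phi> Q * min_S_dist S \<xi> Q))}"
  proof (rule dense_gdelta_limsup_ge)
    show "open {\<xi>. r < real Q * \<Phi> Q * min_S_dist S \<xi> Q}" if "Q \<ge> 1" for Q r
      using that \<Phi>(1)[OF that] by (intro open_mult_min_S_dist_greater mult_pos_pos) auto
    fix r N and V :: "real set"
    assume V: "open V" "V \<noteq> {}"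
    obtain x e where e: "e > 0" "\<And>y. \<bar>y - x\<bar> < e \<Longrightarrow> y \<in> V"
      using V unfolding open_dist dist_real_def by blast
    obtain d :: nat where d: "2 / e < real d" using reals_Archimedean2 by blast
    have "0 < 2 / e" using e by simp
    then have d0: "0 < real d" using d by linarith
    have d2: "1 / real d < e / 2" using d d0 e by (simp add: field_simps)
    define a where "a = \<lfloor>x * real d\<rfloor>"
    have "of_int a \<le> x * real d" "x * real d < of_int a + 1" unfolding a_def by linarith+
    then have a: "of_int a / real d \<le> x" "x < of_int a / real d + 1 / real d"
      using d0 by (auto simp: field_simps)
    have "\<forall>\<^sub>F Q in sequentially. 2 * real d * r < \<Phi> Q"
      using \<Phi>(2) by (simp add: filterlim_at_top_dense)
    then have ev: "\<forall>\<^sub>F Q in sequentially. 2 * real d * r < \<Phi> Q \<and> Q \<ge> max 1 N"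
      using eventually_ge_at_top[of "max 1 N"] by eventually_elim simp
    obtain Q where Q: "2 * real d * r < \<Phi> Q" "Q \<ge> 1" "Q \<ge> N"
      using eventually_happens'[OF sequentially_bot ev] by auto
    define \<eta> where "\<eta> = 1 / (2 * real d * real Q)"
    have Q0: "real Q \<ge> 1" using Q(2) by simp
    have \<eta>: "\<eta> > 0" using d0 Q0 by (simp add: \<eta>_def)
    have "\<eta> = 1 / real d / (2 * real Q)" by (simp add: \<eta>_def)
    also have "\<dots> \<le> 1 / real d / 1" using d0 Q0 by (intro divide_left_mono) auto
    finally have "\<eta> < e / 2" using d2 by simp
    then have "of_int a / real d + \<eta> \<in> V" using \<eta> a d2 by (intro e(2)) (auto simp: abs_less_iff)
    moreover have "\<eta> \<le> min_S_dist S (of_int a / of_int (int d) + \<eta>) Q"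
      using d0 Q0 \<eta> Q(2) by (intro min_S_dist_near_rational[OF S]) (auto simp: \<eta>_def field_simps)
    then have "real Q * \<Phi> Q * \<eta> \<le> real Q * \<Phi> Q * min_S_dist S (of_int a / real d + \<eta>) Q"
      using \<Phi>(1)[OF Q(2)] by (intro mult_left_mono) auto
    moreover have "real Q * \<Phi> Q * \<eta> = \<Phi> Q / (2 * real d)" using Q0 by (simp add: \<eta>_def)
    moreover have "r < \<Phi> Q / (2 * real d)" using Q(1) d0 by (simp add: field_simps)
    ultimately show "\<exists>Q\<ge>N. \<exists>x\<in>V. r < real Q * \<Phi> Q * min_S_dist S x Q"
      using Q(3) by (intro exI[of _ Q] conjI bexI[of _ "of_int a / real d + \<eta>"]) auto
  qed
  then show ?thesis by (simp add: Gamma_tilde_def)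
qed

theorem theorem3p1:
  fixes S :: "nat set"
  assumes "S \<subset> {p. prime p}"
  shows
    "(card S = 1 \<longrightarrow>
        dense_gdelta (Gamma_set S) \<and>
        hausdorff_dim (Gamma_set S) \<ge> 1 / 2 \<and>
        packing_dim (Gamma_set S) = 1 \<and>
        Gamma_set S + Gamma_set S = UNIV \<and>
        Gamma_set S * Gamma_set S = UNIV - {0})
     \<and> (\<forall>\<Phi> :: nat \<Rightarrow> real. (\<forall>n\<ge>1. \<Phi> n > 0) \<and> filterlim \<Phi> at_top at_top \<longrightarrow>
        dense_gdelta (Gamma_tilde S \<Phi>) \<and>
        packing_dim (Gamma_tilde S \<Phi>) = 1 \<and>
        Gamma_tilde S \<Phi> + Gamma_tilde S \<Phi> = UNIV \<and>
        Gamma_tilde S \<Phi> * Gamma_tilde S \<Phi> = UNIV - {0})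
     \<and> (card ({p. prime p} - S) = 1 \<longrightarrow>
        (\<forall>\<xi> :: real. (\<lambda>Q. real Q * min_S_dist S \<xi> Q) \<longlonglongrightarrow> 0))"
proof (intro conjI impI allI; (elim conjE)?)
  have S: "S \<subseteq> {p. prime p}" using assms by blast
  {
    assume "card S = 1"
    then obtain p where Sp: "S = {p}" by (auto simp: card_1_singleton_iff)
    then have p: "prime p" using S by simp
    show \<Gamma>: "dense_gdelta (Gamma_set S)" unfolding Sp by (rule dense_gdelta_Gamma_set[OF p])
    show "hausdorff_dim (Gamma_set S) \<ge> 1 / 2"
      using p_adically_approximable_subset_Gamma_set[OF p] dense_gdelta_nonempty[OF \<Gamma>]
      unfolding Sp by (rule hausdorff_dim_ge_half[OF p])
    show "packing_dim (Gamma_set S) = 1" "Gamma_set S + Gamma_set S = UNIV"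
      "Gamma_set S * Gamma_set S = UNIV - {0}"
      using \<Gamma> by (rule dense_gdelta_packing_dim dense_gdelta_plus dense_gdelta_times[OF _ zero_notin_Gamma_set_times])+
  next
    fix \<Phi> :: "nat \<Rightarrow> real" assume "\<forall>n\<ge>1. \<Phi> n > 0" "filterlim \<Phi> at_top at_top"
    then show \<Gamma>: "dense_gdelta (Gamma_tilde S \<Phi>)" by (intro dense_gdelta_Gamma_tilde[OF S]) auto
    show "packing_dim (Gamma_tilde S \<Phi>) = 1" "Gamma_tilde S \<Phi> + Gamma_tilde S \<Phi> = UNIV"
      "Gamma_tilde S \<Phi> * Gamma_tilde S \<Phi> = UNIV - {0}"
      using \<Gamma> by (rule dense_gdelta_packing_dim dense_gdelta_plus dense_gdelta_times[OF _ zero_notin_Gamma_tilde_times])+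
  next
    fix \<xi> :: real assume "card ({p. prime p} - S) = 1"
    then show "(\<lambda>Q. real Q * min_S_dist S \<xi> Q) \<longlonglongrightarrow> 0" using S by (rule min_S_dist_tendsto_0)
  }
qed

end
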